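(* Let $\{\pi_\theta:\theta\in\Theta\}$ be a smooth parametric policy family. Fix $k$, let $\pi_k^*=\pi_{\theta_k^*}$ with $\theta_k^*\in\Theta$, and for $\lambda>0$ let $\pi_{k+1}^*$ be the exponentially tilted policy $$\pi_{k+1}^*(a\mid s)=\frac{\pi_k^*(a\mid s)\exp\{A^{\pi_k^*}(s,a)/\lambda\}}{\int\pi_k^*(a'\mid s)\exp\{A^{\pi_k^*}(s,a')/\lambda\}\,\mathrm da'}.$$ Suppose $\pi_{k+1}^*=\pi_{\theta_{k+1}^*}$ for some $\theta_{k+1}^*\in\Theta$ (depending on $\lambda$) with $\theta_{k+1}^*\to\theta_k^*$ as $\lambda^{-1}\to0$. Assume that $\theta\mapsto\log\pi_\theta(a\mid s)$ is $C^3$ in a neighborhood of $\theta_k^*$, with the required derivatives integrable under $d^{\pi_k^*}(s)\pi_k^*(a\mid s)$, and that $$F_k^*:=\mathbb E_{d^{\pi_k^*}\pi_k^*}\big[\nabla_\theta\log\pi_{\theta_k^*}(A\mid S)\,\nabla_\theta\log\pi_{\theta_k^*}(A\mid S)^\top\big]$$ is positive definite. Then, as $\lambda^{-1}\to0$, $$\theta_{k+1}^*=\theta_k^*+\frac1\lambda(F_k^* )^{-1}\,\mathbb E_{d^{\pi_k^*}\pi_k^*}\big[A^{\pi_k^*}(S,A)\,\nabla_\theta\log\pi_{\theta_k^*}(A\mid S)\big]+O(\lambda^{-2}).$$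
   Context: Discounted MDP with rewards in $[0,R_{\max}]$, discount $\gamma\in[0,1)$, states $s\in\mathcal X\subseteq\mathbb R^{d_{\mathcal X}}$ and actions $a\in\mathcal A\subseteq\mathbb R^{d_{\mathcal A}}$. For a policy $\pi$, $V^\pi,Q^\pi$ are the discounted state- and action-value functions and $A^\pi=Q^\pi-V^\pi$ the advantage; $d^\pi(\cdot)=(1-\gamma)\sum_{t\ge1}\gamma^{t-1}\mathbb P^\pi(X_t\in\cdot)$ is the normalized discounted state occupancy. $\mathbb E_{d^{\pi}\pi}$ denotes expectation with $S\sim d^\pi$, $A\mid S\sim\pi(\cdot\mid S)$. Here $\pi_\theta(a\mid s)$ denotes the action density. *)

theory Defs
  imports "HOL-Probability.Probability" "HOL-Library.Landau_Symbols"
begin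

(* kernel (s, a) is the joint law of (reward, next state) given the current state and action;
   init is the law of the first state. *)
record ('s, 'a) mdp =
  states :: "'s set"
  actions :: "'a set"
  kernel :: "'s \<times> 'a \<Rightarrow> (real \<times> 's) measure"
  init :: "'s measure"
  discount :: real
  rmax :: real

definition state_space :: "('s::euclidean_space, 'a) mdp \<Rightarrow> 's measure" where
  "state_space M = restrict_space borel (states M)"

(* Carries Lebesgue measure: this is the reference measure da of the action densities. *)
definition action_space :: "('s, 'a::euclidean_space) mdp \<Rightarrow> 'a measure" where
  "action_space M = restrict_space lborel (actions M)"

definition discounted_mdp :: "('s::euclidean_space, 'a::euclidean_space) mdp \<Rightarrow> bool" where
  "discounted_mdp M \<longleftrightarrow>
     states M \<in> sets borel \<and> actions M \<in> sets borel \<and>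
     0 \<le> discount M \<and> discount M < 1 \<and>
     init M \<in> space (prob_algebra (state_space M)) \<and>
     kernel M \<in> state_space M \<Otimes>\<^sub>M action_space M \<rightarrow>\<^sub>M prob_algebra (borel \<Otimes>\<^sub>M state_space M) \<and>
     (\<forall>s\<in>states M. \<forall>a\<in>actions M. AE (r, s') in kernel M (s, a). 0 \<le> r \<and> r \<le> rmax M)"

definition is_policy ::
  "('s::euclidean_space, 'a::euclidean_space) mdp \<Rightarrow> ('s \<Rightarrow> 'a \<Rightarrow> real) \<Rightarrow> bool" where
  "is_policy M p \<longleftrightarrow>
     (\<lambda>(s, a). p s a) \<in> borel_measurable (state_space M \<Otimes>\<^sub>M action_space M) \<and>
     (\<forall>s\<in>states M. (\<forall>a\<in>actions M. 0 \<le> p s a) \<and> (\<integral>\<^sup>+a. ennreal (p s a) \<partial>action_space M) = 1)"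

(* Coordinate t of a trajectory is (R(t-1), X(t), A(t)), with times counted from 0: each step stores
   the reward with the state reached together with it. The reward entry at t = 0 is a dummy. *)
definition step_space ::
  "('s::euclidean_space, 'a::euclidean_space) mdp \<Rightarrow> (real \<times> 's \<times> 'a) measure" where
  "step_space M = borel \<Otimes>\<^sub>M state_space M \<Otimes>\<^sub>M action_space M"

definition act_law ::
  "('s::euclidean_space, 'a::euclidean_space) mdp \<Rightarrow> ('s \<Rightarrow> 'a \<Rightarrow> real) \<Rightarrow>
     real \<times> 's \<Rightarrow> (real \<times> 's \<times> 'a) measure" where
  "act_law M p = (\<lambda>(r, s).
     distr (density (action_space M) (\<lambda>a. ennreal (p s a))) (step_space M) (\<lambda>a. (r, s, a)))"

definition step_law ::
  "('s::euclidean_space, 'a::euclidean_space) mdp \<Rightarrow> ('s \<Rightarrow> 'a \<Rightarrow> real) \<Rightarrow>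
     real \<times> 's \<times> 'a \<Rightarrow> (real \<times> 's \<times> 'a) measure" where
  "step_law M p = (\<lambda>(r, s, a). kernel M (s, a) \<bind> act_law M p)"

(* Ionescu-Tulcea measure of the Markov chain with initial law \<mu> and transitions step_law. *)
definition trajectory_law ::
  "('s::euclidean_space, 'a::euclidean_space) mdp \<Rightarrow> ('s \<Rightarrow> 'a \<Rightarrow> real) \<Rightarrow>
     (real \<times> 's \<times> 'a) measure \<Rightarrow> (nat \<Rightarrow> real \<times> 's \<times> 'a) measure" where
  "trajectory_law M p \<mu> =
     projective_family.lim UNIV
       (Ionescu_Tulcea.CI
          (\<lambda>n \<omega>. case n of 0 \<Rightarrow> \<mu> | Suc m \<Rightarrow> step_law M p (\<omega> m)) (\<lambda>_. step_space M))
       (\<lambda>_. step_space M)"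

definition discounted_return ::
  "('s, 'a) mdp \<Rightarrow> (nat \<Rightarrow> real \<times> 's \<times> 'a) \<Rightarrow> real" where
  "discounted_return M \<omega> = (\<Sum>t. discount M ^ t * fst (\<omega> (Suc t)))"

definition V_fun ::
  "('s::euclidean_space, 'a::euclidean_space) mdp \<Rightarrow> ('s \<Rightarrow> 'a \<Rightarrow> real) \<Rightarrow> 's \<Rightarrow> real" where
  "V_fun M p s = (LINT \<omega>|trajectory_law M p (act_law M p (0, s)). discounted_return M \<omega>)"

definition Q_fun ::
  "('s::euclidean_space, 'a::euclidean_space) mdp \<Rightarrow> ('s \<Rightarrow> 'a \<Rightarrow> real) \<Rightarrow> 's \<Rightarrow> 'a \<Rightarrow> real" where
  "Q_fun M p s a =
     (LINT \<omega>|trajectory_law M p (return (step_space M) (0, s, a)). discounted_return M \<omega>)"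

definition advantage ::
  "('s::euclidean_space, 'a::euclidean_space) mdp \<Rightarrow> ('s \<Rightarrow> 'a \<Rightarrow> real) \<Rightarrow> 's \<Rightarrow> 'a \<Rightarrow> real" where
  "advantage M p s a = Q_fun M p s a - V_fun M p s"

definition occupancy ::
  "('s::euclidean_space, 'a::euclidean_space) mdp \<Rightarrow> ('s \<Rightarrow> 'a \<Rightarrow> real) \<Rightarrow> 's measure" where
  "occupancy M p =
     measure_of (states M) (sets (state_space M))
       (\<lambda>B. ennreal (1 - discount M) *
          (\<Sum>t. ennreal (discount M ^ t) *
             emeasure (distr (trajectory_law M p (init M \<bind> (\<lambda>s. act_law M p (0, s))))
                         (state_space M) (\<lambda>\<omega>. fst (snd (\<omega> t)))) B))"

(* Joint law of (S, A) with S drawn from the occupancy and A | S from the policy density. *)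
definition occupancy_policy ::
  "('s::euclidean_space, 'a::euclidean_space) mdp \<Rightarrow> ('s \<Rightarrow> 'a \<Rightarrow> real) \<Rightarrow> ('s \<times> 'a) measure" where
  "occupancy_policy M p =
     density (occupancy M p \<Otimes>\<^sub>M action_space M) (\<lambda>(s, a). ennreal (p s a))"

definition tilted ::
  "('s::euclidean_space, 'a::euclidean_space) mdp \<Rightarrow> ('s \<Rightarrow> 'a \<Rightarrow> real) \<Rightarrow> real \<Rightarrow>
     's \<Rightarrow> 'a \<Rightarrow> real" where
  "tilted M p lam s a =
     p s a * exp (advantage M p s a / lam) /
     (LINT a'|action_space M. p s a' * exp (advantage M p s a' / lam))"

definition partial_deriv :: "'n \<Rightarrow> (real ^ 'n \<Rightarrow> real) \<Rightarrow> real ^ 'n::finite \<Rightarrow> real" where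
  "partial_deriv i f x = frechet_derivative f (at x) (axis i 1)"

definition gradient :: "(real ^ 'n \<Rightarrow> real) \<Rightarrow> real ^ 'n::finite \<Rightarrow> real ^ 'n" where
  "gradient f x = (\<chi> i. partial_deriv i f x)"

(* Intended for open U, where the derivatives at x do not see the complement. *)
primrec C_k_on :: "nat \<Rightarrow> (real ^ 'n::finite \<Rightarrow> real) \<Rightarrow> (real ^ 'n) set \<Rightarrow> bool" where
  "C_k_on 0 f U \<longleftrightarrow> continuous_on U f"
| "C_k_on (Suc k) f U \<longleftrightarrow>
     (\<forall>x\<in>U. f differentiable (at x)) \<and> (\<forall>i. C_k_on k (partial_deriv i f) U)"

definition score ::
  "(real ^ 'n \<Rightarrow> 's \<Rightarrow> 'a \<Rightarrow> real) \<Rightarrow> real ^ 'n::finite \<Rightarrow> 's \<Rightarrow> 'a \<Rightarrow> real ^ 'n" where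
  "score pol \<theta> s a = gradient (\<lambda>\<theta>'. ln (pol \<theta>' s a)) \<theta>"

definition outer :: "real ^ 'n::finite \<Rightarrow> real ^ 'n \<Rightarrow> real ^ 'n ^ 'n" where
  "outer u v = (\<chi> i j. u $ i * v $ j)"

definition fisher ::
  "('s::euclidean_space, 'a::euclidean_space) mdp \<Rightarrow> (real ^ 'n \<Rightarrow> 's \<Rightarrow> 'a \<Rightarrow> real) \<Rightarrow>
     real ^ 'n::finite \<Rightarrow> real ^ 'n ^ 'n" where
  "fisher M pol \<theta> =
     (LINT (s, a)|occupancy_policy M (pol \<theta>). outer (score pol \<theta> s a) (score pol \<theta> s a))"

definition pos_def :: "real ^ 'n ^ 'n::finite \<Rightarrow> bool" where
  "pos_def A \<longleftrightarrow> transpose A = A \<and> (\<forall>v. v \<noteq> 0 \<longrightarrow> v \<bullet> (A *v v) > 0)"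

end

theory Submission
  imports Defs
begin

text \<open>
  The tilting identity holds for every single state-action pair, not just on average:
  the log-density ratio of the new and the old policy at \<open>(s, a)\<close> is \<open>A(s, a)/\<lambda> - ln Z(s, \<lambda>)\<close>. The
  advantage is bounded and has mean zero under \<open>\<pi>(\<cdot>|s)\<close>, so \<open>ln Z(s, \<lambda>) = O(\<lambda>\<^sup>-\<^sup>2)\<close>. A pointwise Taylor
  expansion of the log-density, with the score \<open>g\<close> and \<open>\<delta> = \<theta>\<^sub>k\<^sub>+\<^sub>1 - \<theta>\<^sub>k\<close>, turns this into
  \<open>g(s, a) \<bullet> \<delta> = A(s, a)/\<lambda> + O(\<bar>\<delta>\<bar>\<^sup>2 + \<lambda>\<^sup>-\<^sup>2)\<close>. As the Fisher matrix is positive definite, finitely many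
  scores form a basis, whence \<open>\<delta> = v/\<lambda> + O(\<lambda>\<^sup>-\<^sup>2)\<close> for some \<open>v\<close>, and comparing first-order
  terms gives \<open>g(s, a) \<bullet> v = A(s, a)\<close> for all \<open>(s, a)\<close>. Multiplying by \<open>g\<close> and integrating yields
  \<open>E[A g] = F v\<close>.
\<close>

section \<open>Marginals and discounted sums of a Markov chain\<close>

text \<open>The construction behind \<open>trajectory_law\<close> for an arbitrary space and kernel,
  so that the Markov chain facts can be proved free of the MDP structure.\<close>

definition chain_law ::
  "'x measure \<Rightarrow> ('x \<Rightarrow> 'x measure) \<Rightarrow> 'x measure \<Rightarrow> (nat \<Rightarrow> 'x) measure" where
  "chain_law N K \<mu> =
     projective_family.lim UNIV
       (Ionescu_Tulcea.CI (\<lambda>n \<omega>. case n of 0 \<Rightarrow> \<mu> | Suc m \<Rightarrow> K (\<omega> m)) (\<lambda>_. N)) (\<lambda>_. N)"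

text \<open>The new step is appended last, in agreement with
  \<open>distr_coordinate_Suc\<close>.\<close>

primrec kernel_power ::
  "'x measure \<Rightarrow> ('x \<Rightarrow> 'x measure) \<Rightarrow> nat \<Rightarrow> 'x \<Rightarrow> 'x measure" where
  "kernel_power N K 0 = return N"
| "kernel_power N K (Suc t) = (\<lambda>x. kernel_power N K t x \<bind> K)"

lemma kernel_power_measurable:
  assumes "K \<in> N \<rightarrow>\<^sub>M prob_algebra N"
  shows "kernel_power N K t \<in> N \<rightarrow>\<^sub>M prob_algebra N"
  by (induction t) (use assms in \<open>auto intro!: measurable_bind_prob_space\<close>)

locale markov_chain =
  fixes N :: "'x measure" and K :: "'x \<Rightarrow> 'x measure" and \<mu> :: "'x measure"
  assumes kernel: "K \<in> N \<rightarrow>\<^sub>M prob_algebra N"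
    and start: "\<mu> \<in> space (prob_algebra N)"
begin

abbreviation transition :: "nat \<Rightarrow> (nat \<Rightarrow> 'x) \<Rightarrow> 'x measure" where
  "transition \<equiv> (\<lambda>n \<omega>. case n of 0 \<Rightarrow> \<mu> | Suc m \<Rightarrow> K (\<omega> m))"

lemma transition_measurable: "transition n \<in> PiM {0..<n} (\<lambda>_. N) \<rightarrow>\<^sub>M prob_algebra N"
proof (cases n)
  case 0
  then show ?thesis using start by simp
next
  case (Suc m)
  have "(\<lambda>\<omega>. K (\<omega> m)) \<in> PiM {0..<Suc m} (\<lambda>_. N) \<rightarrow>\<^sub>M prob_algebra N"
    by (rule measurable_compose[where N=N, OF _ kernel]) simp
  then show ?thesis using Suc by simp
qed

lemma transition_prob_space:
  "\<omega> \<in> space (PiM {0..<n} (\<lambda>_. N)) \<Longrightarrow> prob_space (transition n \<omega>)"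
  using measurable_space[OF transition_measurable, of \<omega> n] by (simp add: space_prob_algebra)

sublocale IT: Ionescu_Tulcea transition "\<lambda>_. N"
  by (rule Ionescu_Tulcea.intro)
     (rule measurable_prob_algebraD[OF transition_measurable], erule transition_prob_space)

lemma chain_law_eq: "chain_law N K \<mu> = IT.PF.lim"
  by (simp add: chain_law_def)

lemma sets_chain_law: "sets (chain_law N K \<mu>) = sets (PiM UNIV (\<lambda>_. N))"
  by (simp add: chain_law_eq)

lemma measurable_coordinate: "(\<lambda>\<omega>. \<omega> t) \<in> chain_law N K \<mu> \<rightarrow>\<^sub>M N"
  by (subst measurable_cong_sets[OF sets_chain_law refl]) simp

text \<open>\<open>IT.CI J\<close> is the projection to \<open>J\<close> of the law of the first
  \<open>IT.up_to J\<close> coordinates. For an initial segment \<open>IT.up_to\<close> is its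
  length, and the projection is trivial.\<close>

lemma CI_eq_C: "IT.CI {0..<n} = IT.C 0 n (\<lambda>_. undefined)"
proof -
  have "IT.up_to {0..<n} = n"
    using IT.up_to_iff_Ico[of "{0..<n}" n] IT.up_to[of "{0..<n}"]
    by (metis antisym finite_atLeastLessThan ivl_subset order_refl zero_le le_zero_eq)
  then show ?thesis
    using IT.distr_C[of n n "\<lambda>_. undefined" 0] by (simp add: IT.CI_def)
qed

text \<open>A pushforward keeps the total mass, so it is enough to look at the projection to the
  empty index set, whose law is known from the projective family.\<close>

lemma chain_law_prob_space: "prob_space (chain_law N K \<mu>)"
proof -
  have "prob_space (distr IT.PF.lim (PiM {} (\<lambda>_. N)) (\<lambda>x. restrict x {}))"
    by (subst IT.distr_lim) (auto intro: IT.PF.prob_space_P)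
  then show ?thesis
    unfolding chain_law_eq
    by (rule prob_space_distrD[rotated]) (intro measurable_restrict, simp)
qed

text \<open>The coordinate factors through the restriction to the first \<open>n\<close>
  coordinates, and the law of that restriction is the finite-stage measure.\<close>

lemma distr_coordinate_C:
  assumes "t < n"
  shows "distr (chain_law N K \<mu>) N (\<lambda>\<omega>. \<omega> t) = distr (IT.C 0 n (\<lambda>_. undefined)) N (\<lambda>\<omega>. \<omega> t)"
proof -
  have "distr (IT.C 0 n (\<lambda>_. undefined)) N (\<lambda>\<omega>. \<omega> t)
     = distr (distr IT.PF.lim (PiM {0..<n} (\<lambda>_. N)) (\<lambda>x. restrict x {0..<n})) N (\<lambda>\<omega>. \<omega> t)"
    by (simp add: IT.distr_lim CI_eq_C)
  also have "\<dots> = distr IT.PF.lim N ((\<lambda>\<omega>. \<omega> t) \<circ> (\<lambda>x. restrict x {0..<n}))"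
    using assms
    by (intro distr_distr measurable_component_singleton)
       (auto intro!: measurable_restrict simp: measurable_cong_sets[OF IT.PF.sets_lim refl])
  also have "\<dots> = distr IT.PF.lim N (\<lambda>\<omega>. \<omega> t)"
    using assms by (simp add: comp_def)
  finally show ?thesis by (simp add: chain_law_eq)
qed

text \<open>Stage \<open>n\<close> is the pushforward of \<open>transition n \<omega>\<close> under
  \<open>fun_upd \<omega> n\<close>, and reading coordinate \<open>n\<close> undoes the
  update.\<close>

lemma distr_C_last:
  "distr (IT.C 0 (Suc n) (\<lambda>_. undefined)) N (\<lambda>\<omega>. \<omega> n) = IT.C 0 n (\<lambda>_. undefined) \<bind> transition n"
proof -
  let ?C = "IT.C 0 n (\<lambda>_. undefined)"
  have u: "(\<lambda>_::nat. undefined) \<in> space (PiM {0..<0} (\<lambda>_. N))" by (auto simp: space_PiM)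
  have sC: "sets ?C = sets (PiM {0..<n} (\<lambda>_. N))" using IT.sets_C[OF u, of n] by simp
  have spC: "space ?C = space (PiM {0..<n} (\<lambda>_. N))" by (rule sets_eq_imp_space_eq[OF sC])
  have "distr (IT.C 0 (Suc n) (\<lambda>_. undefined)) N (\<lambda>\<omega>. \<omega> n)
      = ?C \<bind> (\<lambda>\<omega>. distr (IT.eP n \<omega>) N (\<lambda>\<omega>. \<omega> n))"
    unfolding IT.C.simps add_0
  proof (rule distr_bind)
    show "IT.eP n \<in> ?C \<rightarrow>\<^sub>M subprob_algebra (PiM {0..<Suc n} (\<lambda>_. N))"
      by (subst measurable_cong_sets[OF sC refl]) (rule IT.measurable_eP)
    show "space ?C \<noteq> {}"
      using IT.prob_space_C[OF u] by (rule prob_space.not_empty)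
  qed simp
  also have "\<dots> = ?C \<bind> transition n"
  proof (rule bind_cong[OF refl])
    fix \<omega> assume "\<omega> \<in> space ?C"
    then have \<omega>: "\<omega> \<in> space (PiM {0..<n} (\<lambda>_. N))" by (simp add: spC)
    have sP: "sets (transition n \<omega>) = sets N" by (rule IT.sets_P[OF \<omega>])
    have "distr (IT.eP n \<omega>) N (\<lambda>\<omega>. \<omega> n) = distr (transition n \<omega>) N ((\<lambda>\<omega>. \<omega> n) \<circ> fun_upd \<omega> n)"
      unfolding IT.eP_def
    proof (rule distr_distr)
      show "fun_upd \<omega> n \<in> transition n \<omega> \<rightarrow>\<^sub>M PiM {0..<Suc n} (\<lambda>_. N)"
        by (rule measurable_fun_upd[where J="{0..<n}"])
           (use \<omega> in \<open>auto simp: measurable_cong_sets[OF sP refl]\<close>)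
    qed simp
    also have "\<dots> = transition n \<omega>"
      by (simp add: comp_def) (rule distr_id2[OF sP[symmetric]])
    finally show "distr (IT.eP n \<omega>) N (\<lambda>\<omega>. \<omega> n) = transition n \<omega>" .
  qed
  finally show ?thesis .
qed

lemma distr_coordinate_0: "distr (chain_law N K \<mu>) N (\<lambda>\<omega>. \<omega> 0) = \<mu>"
proof -
  have "distr (chain_law N K \<mu>) N (\<lambda>\<omega>. \<omega> 0) = IT.C 0 0 (\<lambda>_. undefined) \<bind> transition 0"
    using distr_coordinate_C[of 0 "Suc 0"] distr_C_last[of 0] by simp
  also have "\<dots> = transition 0 (\<lambda>_. undefined)"
    unfolding IT.C.simps by (rule bind_return[OF IT.P]) simp
  finally show ?thesis by simp
qed

text \<open>This is the Markov property: the transition to time \<open>Suc t\<close> reads only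
  coordinate \<open>t\<close>, so the bind over the whole history factors through the law of that
  coordinate.\<close>

lemma distr_coordinate_Suc:
  "distr (chain_law N K \<mu>) N (\<lambda>\<omega>. \<omega> (Suc t)) = distr (chain_law N K \<mu>) N (\<lambda>\<omega>. \<omega> t) \<bind> K"
proof -
  let ?C = "IT.C 0 (Suc t) (\<lambda>_. undefined)"
  have u: "(\<lambda>_::nat. undefined) \<in> space (PiM {0..<0} (\<lambda>_. N))" by (auto simp: space_PiM)
  have sC: "sets ?C = sets (PiM {0..<Suc t} (\<lambda>_. N))" using IT.sets_C[OF u, of "Suc t"] by (simp del: IT.C.simps)
  have "distr (chain_law N K \<mu>) N (\<lambda>\<omega>. \<omega> (Suc t)) = ?C \<bind> (\<lambda>\<omega>. K (\<omega> t))"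
    using distr_coordinate_C[of "Suc t" "Suc (Suc t)"] distr_C_last[of "Suc t"]
    by (simp del: IT.C.simps)
  also have "\<dots> = distr ?C N (\<lambda>\<omega>. \<omega> t) \<bind> K"
  proof (rule bind_distr[symmetric])
    show "(\<lambda>\<omega>. \<omega> t) \<in> ?C \<rightarrow>\<^sub>M N"
      by (subst measurable_cong_sets[OF sC refl]) simp
    show "K \<in> N \<rightarrow>\<^sub>M subprob_algebra N" by (rule measurable_prob_algebraD[OF kernel])
    show "space ?C \<noteq> {}"
      using IT.prob_space_C[OF u] by (rule prob_space.not_empty)
  qed
  also have "distr ?C N (\<lambda>\<omega>. \<omega> t) = distr (chain_law N K \<mu>) N (\<lambda>\<omega>. \<omega> t)"
    using distr_coordinate_C[of t "Suc t"] by (simp del: IT.C.simps)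
  finally show ?thesis .
qed

lemma distr_coordinate:
  "distr (chain_law N K \<mu>) N (\<lambda>\<omega>. \<omega> t) = \<mu> \<bind> kernel_power N K t"
proof (induction t)
  case 0
  have "\<mu> \<bind> return N = \<mu>" using start by (simp add: bind_return'' space_prob_algebra)
  then show ?case by (simp add: distr_coordinate_0)
next
  case (Suc t)
  have s: "sets \<mu> = sets N" using start by (simp add: space_prob_algebra)
  have "\<mu> \<bind> kernel_power N K t \<bind> K = \<mu> \<bind> (\<lambda>x. kernel_power N K t x \<bind> K)"
    by (rule bind_assoc[where N=N and R=N])
       (auto simp: measurable_cong_sets[OF s refl]
         intro!: measurable_prob_algebraD kernel kernel_power_measurable[OF kernel])
  then show ?case by (simp add: distr_coordinate_Suc Suc)
qed

end

section \<open>Discounted sums along the chain\<close>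

definition discounted_value ::
  "'x measure \<Rightarrow> ('x \<Rightarrow> 'x measure) \<Rightarrow> real \<Rightarrow> ('x \<Rightarrow> real) \<Rightarrow> 'x \<Rightarrow> real" where
  "discounted_value N K \<gamma> c x = (\<Sum>t. \<gamma> ^ t * (LINT y|kernel_power N K (Suc t) x. c y))"

text \<open>The interesting case is a non-integrable \<open>c\<close>, whose integral is 0 by
  default. Then \<open>0 \<le> B\<close> suffices, and this holds because a probability space has a
  point.\<close>

lemma abs_integral_le_bound:
  fixes c :: "'x \<Rightarrow> real"
  assumes "L \<in> space (prob_algebra N)" and "\<And>y. y \<in> space N \<Longrightarrow> \<bar>c y\<bar> \<le> B"
  shows "\<bar>LINT y|L. c y\<bar> \<le> B"
proof -
  interpret prob_space L using assms(1) by (simp add: space_prob_algebra)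
  have sp: "space L = space N"
    using assms(1) by (intro sets_eq_imp_space_eq) (simp add: space_prob_algebra)
  obtain z where "z \<in> space L" using not_empty by blast
  then have "\<bar>c z\<bar> \<le> B" using assms(2)[of z] sp by simp
  then have "0 \<le> B" by linarith
  show ?thesis
  proof (cases "integrable L c")
    case True
    have "norm (LINT y|L. c y) \<le> (LINT y|L. norm (c y))" by (rule integral_norm_bound)
    also have "\<dots> \<le> (LINT y|L. B)"
      using True assms(2) by (intro integral_mono) (auto simp: sp)
    finally show ?thesis by (simp add: prob_space)
  next
    case False
    then show ?thesis using \<open>0 \<le> B\<close> by (simp add: not_integrable_integral_eq)
  qed
qed

context
  fixes N :: "'x measure" and K :: "'x \<Rightarrow> 'x measure" and \<gamma> B :: real and c :: "'x \<Rightarrow> real"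
  assumes K: "K \<in> N \<rightarrow>\<^sub>M prob_algebra N"
    and c_meas: "c \<in> borel_measurable N"
    and c_bound: "\<And>y. y \<in> space N \<Longrightarrow> \<bar>c y\<bar> \<le> B"
    and \<gamma>: "0 \<le> \<gamma>" "\<gamma> < 1"
begin

lemma discounted_value_measurable: "discounted_value N K \<gamma> c \<in> borel_measurable N"
proof -
  have "(\<lambda>x. LINT y|kernel_power N K t x. c y) \<in> borel_measurable N" for t
    by (rule measurable_compose[OF measurable_prob_algebraD[OF kernel_power_measurable[OF K]]])
       (rule integral_measurable_subprob_algebra[OF c_meas])
  then show ?thesis
    unfolding discounted_value_def[abs_def]
    by (intro borel_measurable_suminf borel_measurable_times borel_measurable_const)
qed

lemma discounted_summand_bound:
  assumes "x \<in> space N"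
  shows "\<bar>\<gamma> ^ t * (LINT y|kernel_power N K (Suc t) x. c y)\<bar> \<le> B * \<gamma> ^ t"
proof -
  have "\<bar>LINT y|kernel_power N K (Suc t) x. c y\<bar> \<le> B"
    by (rule abs_integral_le_bound[OF measurable_space[OF kernel_power_measurable[OF K] assms] c_bound])
  then have "\<gamma> ^ t * \<bar>LINT y|kernel_power N K (Suc t) x. c y\<bar> \<le> \<gamma> ^ t * B"
    by (intro mult_left_mono) (use \<gamma> in auto)
  then show ?thesis using \<gamma> by (simp add: abs_mult mult.commute)
qed

lemma discounted_value_bound:
  assumes "x \<in> space N"
  shows "\<bar>discounted_value N K \<gamma> c x\<bar> \<le> B / (1 - \<gamma>)"
proof -
  have s: "summable (\<lambda>t. B * \<gamma> ^ t)" using \<gamma> by simp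
  have "norm (discounted_value N K \<gamma> c x) \<le> (\<Sum>t. B * \<gamma> ^ t)"
    unfolding discounted_value_def
    by (rule norm_suminf_le[OF _ s]) (use discounted_summand_bound[OF assms] in simp)
  also have "\<dots> = B / (1 - \<gamma>)"
    using \<gamma> by (simp add: suminf_mult suminf_geometric)
  finally show ?thesis by simp
qed

text \<open>Sum and integral are exchanged twice, once under the chain law and once under
  \<open>\<mu>\<close>, each time dominated by the geometric series \<open>B * \<gamma> ^ t\<close>;
  in between, \<open>distr_coordinate\<close> evaluates each term. The return starts at coordinate
  1, hence the power \<open>Suc t\<close> in \<open>discounted_value\<close>.\<close>

lemma integral_discounted_sum_bounded:
  assumes \<mu>: "\<mu> \<in> space (prob_algebra N)"
  shows "(LINT \<omega>|chain_law N K \<mu>. (\<Sum>t. \<gamma> ^ t * c (\<omega> (Suc t)))) = (LINT x|\<mu>. discounted_value N K \<gamma> c x)"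
proof -
  interpret markov_chain N K \<mu> by standard (fact K \<mu>)+
  interpret T: prob_space "chain_law N K \<mu>" by (rule chain_law_prob_space)
  interpret \<mu>: prob_space \<mu> using \<mu> by (simp add: space_prob_algebra)
  have s\<mu>: "sets \<mu> = sets N" using \<mu> by (simp add: space_prob_algebra)
  have sp\<mu>: "space \<mu> = space N" by (rule sets_eq_imp_space_eq[OF s\<mu>])
  have spT: "\<omega> t \<in> space N" if "\<omega> \<in> space (chain_law N K \<mu>)" for \<omega> t
    using measurable_space[OF measurable_coordinate that] .
  have mT: "(\<lambda>\<omega>. c (\<omega> t)) \<in> borel_measurable (chain_law N K \<mu>)" for t
    by (rule measurable_compose[OF measurable_coordinate c_meas])
  have mk: "(\<lambda>x. LINT y|kernel_power N K t x. c y) \<in> borel_measurable \<mu>" for t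
    unfolding measurable_cong_sets[OF s\<mu> refl]
    by (rule measurable_compose[OF measurable_prob_algebraD[OF kernel_power_measurable[OF K]]])
       (rule integral_measurable_subprob_algebra[OF c_meas])
  have coord: "(LINT \<omega>|chain_law N K \<mu>. c (\<omega> t)) = (LINT x|\<mu>. (LINT y|kernel_power N K t x. c y))" for t
  proof -
    have "(LINT \<omega>|chain_law N K \<mu>. c (\<omega> t)) = (LINT y|distr (chain_law N K \<mu>) N (\<lambda>\<omega>. \<omega> t). c y)"
      by (rule integral_distr[symmetric, OF measurable_coordinate c_meas])
    also have "\<dots> = (LINT y|(\<mu> \<bind> kernel_power N K t). c y)"
      by (simp add: distr_coordinate)
    also have "\<dots> = (LINT x|\<mu>. (LINT y|kernel_power N K t x. c y))"
    proof (rule integral_bind[where K=N and B=B and B'=1, OF c_meas c_bound])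
      show "kernel_power N K t \<in> \<mu> \<rightarrow>\<^sub>M subprob_algebra N"
        unfolding measurable_cong_sets[OF s\<mu> refl]
        by (rule measurable_prob_algebraD[OF kernel_power_measurable[OF K]])
      show "finite_measure \<mu>" by (rule \<mu>.finite_measure_axioms)
      show "AE x in \<mu>. emeasure (kernel_power N K t x) (space (kernel_power N K t x)) \<le> ennreal 1"
      proof (rule AE_I2)
        fix x assume "x \<in> space \<mu>"
        then have "prob_space (kernel_power N K t x)"
          using measurable_space[OF kernel_power_measurable[OF K]] by (simp add: sp\<mu> space_prob_algebra)
        then show "emeasure (kernel_power N K t x) (space (kernel_power N K t x)) \<le> ennreal 1"
          by (simp add: prob_space.emeasure_space_1)
      qed
    qed
    finally show ?thesis .
  qed
  have sB: "summable (\<lambda>t. B * \<gamma> ^ t)" using \<gamma> by simp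
  have bT: "\<bar>\<gamma> ^ t * c (\<omega> (Suc t))\<bar> \<le> B * \<gamma> ^ t" if "\<omega> \<in> space (chain_law N K \<mu>)" for \<omega> t
    using mult_left_mono[OF c_bound[OF spT[OF that, of "Suc t"]], of "\<gamma> ^ t"] \<gamma>
    by (simp add: abs_mult mult.commute)
  have iT: "integrable (chain_law N K \<mu>) (\<lambda>\<omega>. \<gamma> ^ t * c (\<omega> (Suc t)))" for t
    by (rule T.integrable_const_bound[where B="B * \<gamma> ^ t"]) (use bT mT in auto)
  have i\<mu>: "integrable \<mu> (\<lambda>x. \<gamma> ^ t * (LINT y|kernel_power N K (Suc t) x. c y))" for t
    by (rule \<mu>.integrable_const_bound[where B="B * \<gamma> ^ t"])
       (use discounted_summand_bound mk in \<open>auto simp: sp\<mu> simp del: kernel_power.simps\<close>)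
  have "(LINT \<omega>|chain_law N K \<mu>. (\<Sum>t. \<gamma> ^ t * c (\<omega> (Suc t))))
      = (\<Sum>t. (LINT \<omega>|chain_law N K \<mu>. \<gamma> ^ t * c (\<omega> (Suc t))))"
  proof (rule integral_suminf[OF iT])
    show "AE \<omega> in chain_law N K \<mu>. summable (\<lambda>t. norm (\<gamma> ^ t * c (\<omega> (Suc t))))"
      by (rule AE_I2, rule summable_comparison_test[OF _ sB]) (use bT in auto)
    show "summable (\<lambda>t. LINT \<omega>|chain_law N K \<mu>. norm (\<gamma> ^ t * c (\<omega> (Suc t))))"
    proof (rule summable_comparison_test[OF _ sB], intro exI[of _ 0] allI impI)
      fix t
      have "(LINT \<omega>|chain_law N K \<mu>. norm (\<gamma> ^ t * c (\<omega> (Suc t)))) \<le> (LINT \<omega>|chain_law N K \<mu>. B * \<gamma> ^ t)"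
        by (rule integral_mono) (use iT bT in auto)
      then show "norm (LINT \<omega>|chain_law N K \<mu>. norm (\<gamma> ^ t * c (\<omega> (Suc t)))) \<le> B * \<gamma> ^ t"
        by (simp add: T.prob_space)
    qed
  qed
  also have "\<dots> = (\<Sum>t. (LINT x|\<mu>. \<gamma> ^ t * (LINT y|kernel_power N K (Suc t) x. c y)))"
    by (simp add: coord del: kernel_power.simps)
  also have "\<dots> = (LINT x|\<mu>. discounted_value N K \<gamma> c x)"
    unfolding discounted_value_def
  proof (rule integral_suminf[symmetric, OF i\<mu>])
    show "AE x in \<mu>. summable (\<lambda>t. norm (\<gamma> ^ t * (LINT y|kernel_power N K (Suc t) x. c y)))"
      by (rule AE_I2, rule summable_comparison_test[OF _ sB])
         (use discounted_summand_bound in \<open>auto simp: sp\<mu> simp del: kernel_power.simps\<close>)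
    show "summable (\<lambda>t. LINT x|\<mu>. norm (\<gamma> ^ t * (LINT y|kernel_power N K (Suc t) x. c y)))"
    proof (rule summable_comparison_test[OF _ sB], intro exI[of _ 0] allI impI)
      fix t
      have "(LINT x|\<mu>. norm (\<gamma> ^ t * (LINT y|kernel_power N K (Suc t) x. c y))) \<le> (LINT x|\<mu>. B * \<gamma> ^ t)"
        by (rule integral_mono)
           (use i\<mu> discounted_summand_bound in \<open>auto simp: sp\<mu> simp del: kernel_power.simps\<close>)
      then show "norm (LINT x|\<mu>. norm (\<gamma> ^ t * (LINT y|kernel_power N K (Suc t) x. c y))) \<le> B * \<gamma> ^ t"
        by (simp add: \<mu>.prob_space del: kernel_power.simps)
    qed
  qed
  finally show ?thesis .
qed

end

lemma integral_discounted_sum: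
  fixes f :: "'x \<Rightarrow> real"
  assumes K: "K \<in> N \<rightarrow>\<^sub>M prob_algebra N" and f[measurable]: "f \<in> borel_measurable N"
    and f_bound: "\<And>x. x \<in> space N \<Longrightarrow> AE y in K x. \<bar>f y\<bar> \<le> B"
    and \<gamma>: "0 \<le> \<gamma>" "\<gamma> < 1"
  obtains G where "G \<in> borel_measurable N" and "\<forall>x\<in>space N. \<bar>G x\<bar> \<le> \<bar>B\<bar> / (1 - \<gamma>)"
    and "\<forall>\<mu>\<in>space (prob_algebra N).
          (LINT \<omega>|chain_law N K \<mu>. (\<Sum>t. \<gamma> ^ t * f (\<omega> (Suc t)))) = (LINT x|\<mu>. G x)"
proof -
  \<comment> \<open>The reward bound only holds almost surely; truncation makes it hold everywhere without
     changing the return up to a null set.\<close>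
  define c where "c y = max (- B) (min B (f y))" for y
  have c_meas[measurable]: "c \<in> borel_measurable N" unfolding c_def[abs_def] by measurable
  have c_bound: "\<bar>c y\<bar> \<le> \<bar>B\<bar>" for y by (auto simp: c_def)
  have eq: "(LINT \<omega>|chain_law N K \<mu>. (\<Sum>t. \<gamma> ^ t * f (\<omega> (Suc t))))
      = (LINT \<omega>|chain_law N K \<mu>. (\<Sum>t. \<gamma> ^ t * c (\<omega> (Suc t))))" if \<mu>: "\<mu> \<in> space (prob_algebra N)" for \<mu>
  proof -
    interpret markov_chain N K \<mu> by standard (fact K \<mu>)+
    have mT: "(\<lambda>\<omega>. g (\<omega> t)) \<in> borel_measurable (chain_law N K \<mu>)" if "g \<in> borel_measurable N"
      for t and g :: "'x \<Rightarrow> real"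
      by (rule measurable_compose[OF measurable_coordinate that])
    \<comment> \<open>Coordinate \<open>Suc t\<close> has been drawn from \<open>K\<close>, so it
      inherits the almost sure bound. Coordinate 0 comes from \<open>\<mu>\<close> and does not
      occur in the sum.\<close>
    have "AE \<omega> in chain_law N K \<mu>. \<bar>f (\<omega> (Suc t))\<bar> \<le> B" for t
    proof -
      let ?D = "\<lambda>t. distr (chain_law N K \<mu>) N (\<lambda>\<omega>. \<omega> t)"
      have "AE y in ?D t \<bind> K. \<bar>f y\<bar> \<le> B"
        using measurable_prob_algebraD[OF K] f_bound
        by (subst AE_bind[where B=N]) auto
      then have "AE y in ?D (Suc t). \<bar>f y\<bar> \<le> B" unfolding distr_coordinate_Suc .
      then show ?thesis by (subst (asm) AE_distr_iff) (auto intro: measurable_coordinate)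
    qed
    then have "AE \<omega> in chain_law N K \<mu>. \<forall>t. \<bar>f (\<omega> (Suc t))\<bar> \<le> B" by (simp add: AE_all_countable)
    then have "AE \<omega> in chain_law N K \<mu>. ((\<Sum>t. \<gamma> ^ t * f (\<omega> (Suc t)))) = ((\<Sum>t. \<gamma> ^ t * c (\<omega> (Suc t))))"
    proof eventually_elim
      case (elim \<omega>)
      have "f (\<omega> (Suc t)) = c (\<omega> (Suc t))" for t
        using elim[rule_format, of t] unfolding c_def by linarith
      then show ?case by simp
    qed
    then show ?thesis
      by (intro integral_cong_AE borel_measurable_suminf borel_measurable_times borel_measurable_const mT)
         auto
  qed
  show thesis
  proof (rule that)
    show "discounted_value N K \<gamma> c \<in> borel_measurable N"
      by (rule discounted_value_measurable[OF K c_meas c_bound \<gamma>])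
    show "\<forall>x\<in>space N. \<bar>discounted_value N K \<gamma> c x\<bar> \<le> \<bar>B\<bar> / (1 - \<gamma>)"
      using discounted_value_bound[OF K c_meas c_bound \<gamma>] by blast
    show "\<forall>\<mu>\<in>space (prob_algebra N).
        (LINT \<omega>|chain_law N K \<mu>. (\<Sum>t. \<gamma> ^ t * f (\<omega> (Suc t)))) = (LINT x|\<mu>. discounted_value N K \<gamma> c x)"
      using eq integral_discounted_sum_bounded[OF K c_meas c_bound \<gamma>] by simp
  qed
qed

section \<open>Value functions and the tilted policy\<close>

lemma trajectory_law_eq_chain_law:
  "trajectory_law M p \<mu> = chain_law (step_space M) (step_law M p) \<mu>"
  by (simp add: trajectory_law_def chain_law_def)

lemma space_state_space [simp]: "space (state_space M) = states M"
  by (simp add: state_space_def space_restrict_space)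

lemma space_action_space [simp]: "space (action_space M) = actions M"
  by (simp add: action_space_def space_restrict_space)

lemma space_step_space: "space (step_space M) = UNIV \<times> states M \<times> actions M"
  by (simp add: step_space_def space_pair_measure)

context
  fixes M :: "('s::euclidean_space, 'a::euclidean_space) mdp" and p :: "'s \<Rightarrow> 'a \<Rightarrow> real"
  assumes mdp: "discounted_mdp M" and policy: "is_policy M p"
begin

section \<open>Measurability of the action and transition laws\<close>

lemma sigma_finite_action_space: "sigma_finite_measure (action_space M)"
  unfolding action_space_def
  using mdp by (intro sigma_finite_measure_restrict_space sigma_finite_lborel) (simp add: discounted_mdp_def)

lemma policy_measurable: "(\<lambda>(s, a). p s a) \<in> borel_measurable (state_space M \<Otimes>\<^sub>M action_space M)"
  using policy by (simp add: is_policy_def)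

lemma policy_measurable_action: "s \<in> states M \<Longrightarrow> p s \<in> borel_measurable (action_space M)"
  using measurable_compose[OF measurable_Pair1' policy_measurable, of s] by simp

lemma action_density_prob_space:
  assumes "s \<in> states M"
  shows "prob_space (density (action_space M) (\<lambda>a. ennreal (p s a)))"
proof
  have "(\<integral>\<^sup>+a. ennreal (p s a) \<partial>action_space M) = 1"
    using policy assms by (simp add: is_policy_def)
  moreover have "(\<lambda>a. ennreal (p s a)) \<in> borel_measurable (action_space M)"
    using policy_measurable_action[OF assms] by simp
  ultimately show "emeasure (density (action_space M) (\<lambda>a. ennreal (p s a)))
      (space (density (action_space M) (\<lambda>a. ennreal (p s a)))) = 1"
    using sets.top[of "action_space M"]
    by (simp add: emeasure_density cong: nn_integral_cong_simp)
qed

lemma action_embedding_measurable: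
  "s \<in> states M \<Longrightarrow> (\<lambda>a. (r, s, a)) \<in> action_space M \<rightarrow>\<^sub>M step_space M"
  unfolding step_space_def by simp

lemma act_law_in_prob_algebra:
  assumes "s \<in> states M"
  shows "act_law M p (r, s) \<in> space (prob_algebra (step_space M))"
  unfolding act_law_def prod.case space_prob_algebra
  using prob_space.prob_space_distr[OF action_density_prob_space[OF assms], of "\<lambda>a. (r, s, a)" "step_space M"]
    action_embedding_measurable[OF assms]
  by simp

text \<open>Measurability is tested on single events: the mass of \<open>A\<close> is the integral
  over the actions of the density times an indicator, which is measurable in the parameters by
  Tonelli, as the reference measure is sigma-finite.\<close>

lemma act_law_measurable: "act_law M p \<in> borel \<Otimes>\<^sub>M state_space M \<rightarrow>\<^sub>M prob_algebra (step_space M)"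
proof (rule measurable_prob_algebra_generated[OF sets.sigma_sets_eq[symmetric] sets.Int_stable sets.space_closed])
  show "prob_space (act_law M p x)" "sets (act_law M p x) = sets (step_space M)"
    if "x \<in> space (borel \<Otimes>\<^sub>M state_space M)" for x
    using that act_law_in_prob_algebra[of "snd x" "fst x"]
    by (auto simp: space_pair_measure space_prob_algebra)
next
  fix A assume A: "A \<in> sets (step_space M)"
  interpret sigma_finite_measure "action_space M" by (rule sigma_finite_action_space)
  let ?L = "(borel \<Otimes>\<^sub>M state_space M) \<Otimes>\<^sub>M action_space M"
  have "(\<lambda>x. (snd (fst x), snd x)) \<in> ?L \<rightarrow>\<^sub>M state_space M \<Otimes>\<^sub>M action_space M" by simp
  from measurable_compose[OF this policy_measurable]
  have [measurable]: "(\<lambda>x. p (snd (fst x)) (snd x)) \<in> borel_measurable ?L" by simp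
  have "(\<lambda>x. (fst (fst x), snd (fst x), snd x)) \<in> ?L \<rightarrow>\<^sub>M step_space M"
    by (simp add: step_space_def)
  from measurable_compose[OF this borel_measurable_indicator[OF A]]
  have [measurable]: "(\<lambda>x. indicator A (fst (fst x), snd (fst x), snd x) :: ennreal) \<in> borel_measurable ?L" .
  have "(\<lambda>x. \<integral>\<^sup>+a. ennreal (p (snd x) a) * indicator A (fst x, snd x, a) \<partial>action_space M)
      \<in> borel_measurable (borel \<Otimes>\<^sub>M state_space M)"
    by (rule borel_measurable_nn_integral) (simp add: split_beta')
  moreover have "emeasure (act_law M p x) A
      = (\<integral>\<^sup>+a. ennreal (p (snd x) a) * indicator A (fst x, snd x, a) \<partial>action_space M)"
    if x_in: "x \<in> space (borel \<Otimes>\<^sub>M state_space M)" for x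
  proof -
    obtain r s where x: "x = (r, s)" and s: "s \<in> states M"
      using x_in by (cases x) (auto simp: space_pair_measure)
    note emb = action_embedding_measurable[OF s, of r]
    have pm: "(\<lambda>a. ennreal (p s a)) \<in> borel_measurable (action_space M)"
      using policy_measurable_action[OF s] by simp
    have "emeasure (act_law M p x) A = emeasure (density (action_space M) (\<lambda>a. ennreal (p s a)))
        ((\<lambda>a. (r, s, a)) -` A \<inter> space (action_space M))"
      unfolding x act_law_def prod.case using emb A by (subst emeasure_distr) auto
    also have "\<dots> = (\<integral>\<^sup>+a. ennreal (p s a) * indicator ((\<lambda>a. (r, s, a)) -` A \<inter> space (action_space M)) a
        \<partial>action_space M)"
      by (rule emeasure_density[OF pm measurable_sets[OF emb A]])
    also have "\<dots> = (\<integral>\<^sup>+a. ennreal (p (snd x) a) * indicator A (fst x, snd x, a) \<partial>action_space M)"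
      by (rule nn_integral_cong) (simp add: x split: split_indicator)
    finally show ?thesis .
  qed
  ultimately show "(\<lambda>x. emeasure (act_law M p x) A) \<in> borel_measurable (borel \<Otimes>\<^sub>M state_space M)"
    by (simp cong: measurable_cong)
qed

lemma step_law_measurable: "step_law M p \<in> step_space M \<rightarrow>\<^sub>M prob_algebra (step_space M)"
proof -
  have "(\<lambda>x. kernel M (snd x)) \<in> step_space M \<rightarrow>\<^sub>M prob_algebra (borel \<Otimes>\<^sub>M state_space M)"
    unfolding step_space_def
    by (rule measurable_compose[OF measurable_snd]) (use mdp in \<open>simp add: discounted_mdp_def\<close>)
  then have "(\<lambda>x. kernel M (snd x) \<bind> act_law M p) \<in> step_space M \<rightarrow>\<^sub>M prob_algebra (step_space M)"
    by (rule measurable_bind_prob_space[OF _ act_law_measurable])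
  then show ?thesis by (simp add: step_law_def split_beta')
qed

lemma reward_measurable: "fst \<in> borel_measurable (step_space M)"
  by (simp add: step_space_def)

text \<open>\<open>act_law\<close> passes the reward on unchanged, so the almost sure bound of the
  kernel survives the sampling of the action.\<close>

lemma step_law_reward_bound:
  assumes "x \<in> space (step_space M)"
  shows "AE y in step_law M p x. \<bar>fst y\<bar> \<le> rmax M"
proof -
  obtain r s a where x: "x = (r, s, a)" and s: "s \<in> states M" and a: "a \<in> actions M"
    using assms by (cases x) (auto simp: space_step_space)
  have k: "kernel M (s, a) \<in> space (prob_algebra (borel \<Otimes>\<^sub>M state_space M))"
    using mdp s a by (auto simp: discounted_mdp_def space_pair_measure intro: measurable_space)
  then have sk: "sets (kernel M (s, a)) = sets (borel \<Otimes>\<^sub>M state_space M)"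
    by (simp add: space_prob_algebra)
  have spk: "space (kernel M (s, a)) = UNIV \<times> states M"
    using sets_eq_imp_space_eq[OF sk] by (simp add: space_pair_measure)
  note reward_measurable[measurable]
  have "AE z in kernel M (s, a). AE y in act_law M p z. \<bar>fst y\<bar> \<le> rmax M"
  proof -
    have reward: "AE z in kernel M (s, a). 0 \<le> fst z \<and> fst z \<le> rmax M"
      using mdp s a by (auto simp: discounted_mdp_def split_beta')
    show ?thesis
    proof (rule AE_mp[OF reward], rule AE_I2, rule impI)
      fix z assume "z \<in> space (kernel M (s, a))" and z: "0 \<le> fst z \<and> fst z \<le> rmax M"
      then have "snd z \<in> states M" by (auto simp: spk)
      then show "AE y in act_law M p z. \<bar>fst y\<bar> \<le> rmax M"
        using z action_embedding_measurable[of "snd z" "fst z"]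
        unfolding act_law_def split_beta' by (subst AE_distr_iff) auto
    qed
  qed
  then show ?thesis
    unfolding x step_law_def prod.case
    by (subst AE_bind[where B="step_space M"])
       (auto simp: measurable_cong_sets[OF sk refl] intro: measurable_prob_algebraD act_law_measurable)
qed

text \<open>\<open>Q_fun\<close> and \<open>V_fun\<close> are returns of the same chain, started
  from a point mass and from the action law. A single \<open>G\<close> that serves all starting laws
  therefore exhibits \<open>V_fun\<close> as the policy mean of \<open>Q_fun\<close>. The first
  component 0 is the dummy initial reward.\<close>

lemma Q_and_V_from_common_function:
  obtains G where "G \<in> borel_measurable (step_space M)"
    and "\<forall>x\<in>space (step_space M). \<bar>G x\<bar> \<le> \<bar>rmax M\<bar> / (1 - discount M)"
    and "\<forall>s\<in>states M. \<forall>a\<in>actions M. Q_fun M p s a = G (0, s, a)"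
    and "\<forall>s\<in>states M.
           V_fun M p s = (LINT a|density (action_space M) (\<lambda>a. ennreal (p s a)). G (0, s, a))"
proof -
  have \<gamma>: "0 \<le> discount M" "discount M < 1" using mdp by (auto simp: discounted_mdp_def)
  obtain G where G: "G \<in> borel_measurable (step_space M)"
    "\<forall>x\<in>space (step_space M). \<bar>G x\<bar> \<le> \<bar>rmax M\<bar> / (1 - discount M)"
    "\<forall>\<mu>\<in>space (prob_algebra (step_space M)).
        (LINT \<omega>|chain_law (step_space M) (step_law M p) \<mu>. (\<Sum>t. discount M ^ t * fst (\<omega> (Suc t))))
        = (LINT x|\<mu>. G x)"
    by (rule integral_discounted_sum[OF step_law_measurable reward_measurable step_law_reward_bound \<gamma>])
  show thesis
  proof (rule that[OF G(1,2)])
    show "\<forall>s\<in>states M. \<forall>a\<in>actions M. Q_fun M p s a = G (0, s, a)"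
    proof (intro ballI)
      fix s a assume "s \<in> states M" "a \<in> actions M"
      then have x: "(0, s, a) \<in> space (step_space M)" by (simp add: space_step_space)
      have "return (step_space M) (0, s, a) \<in> space (prob_algebra (step_space M))"
        using x by (simp add: space_prob_algebra prob_space_return)
      from G(3)[rule_format, OF this] show "Q_fun M p s a = G (0, s, a)"
        by (simp add: Q_fun_def trajectory_law_eq_chain_law discounted_return_def[abs_def]
            integral_return[OF x G(1)])
    qed
    show "\<forall>s\<in>states M. V_fun M p s = (LINT a|density (action_space M) (\<lambda>a. ennreal (p s a)). G (0, s, a))"
    proof
      fix s assume s: "s \<in> states M"
      have "V_fun M p s = (LINT x|act_law M p (0, s). G x)"
        using G(3)[rule_format, OF act_law_in_prob_algebra[OF s]]
        by (simp add: V_fun_def trajectory_law_eq_chain_law discounted_return_def[abs_def])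
      also have "\<dots> = (LINT a|density (action_space M) (\<lambda>a. ennreal (p s a)). G (0, s, a))"
        unfolding act_law_def prod.case
        using action_embedding_measurable[OF s] by (intro integral_distr G(1)) simp
      finally show "V_fun M p s = (LINT a|density (action_space M) (\<lambda>a. ennreal (p s a)). G (0, s, a))" .
    qed
  qed
qed

text \<open>At a fixed state the advantage is a bounded function of the action minus its own mean.
  The bound may depend on \<open>s\<close>, since the asymptotics are taken at a fixed state-action
  pair.\<close>

lemma advantage_measurable_bounded_centered:
  assumes s: "s \<in> states M"
  defines "D \<equiv> density (action_space M) (\<lambda>a. ennreal (p s a))"
  shows "advantage M p s \<in> borel_measurable (action_space M)"
    and "\<exists>B. \<forall>a\<in>actions M. \<bar>advantage M p s a\<bar> \<le> B"
    and "(LINT a|D. advantage M p s a) = 0"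
proof -
  interpret D: prob_space D unfolding D_def by (rule action_density_prob_space[OF s])
  obtain G where G: "G \<in> borel_measurable (step_space M)"
    "\<forall>x\<in>space (step_space M). \<bar>G x\<bar> \<le> \<bar>rmax M\<bar> / (1 - discount M)"
    "\<forall>s\<in>states M. \<forall>a\<in>actions M. Q_fun M p s a = G (0, s, a)"
    "\<forall>s\<in>states M.
       V_fun M p s = (LINT a|density (action_space M) (\<lambda>a. ennreal (p s a)). G (0, s, a))"
    by (rule Q_and_V_from_common_function)
  have adv: "advantage M p s a = G (0, s, a) - V_fun M p s" if "a \<in> actions M" for a
    using G(3) s that by (simp add: advantage_def)
  have Gm: "(\<lambda>a. G (0, s, a)) \<in> borel_measurable (action_space M)"
    by (rule measurable_compose[OF action_embedding_measurable[OF s] G(1)])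
  have Gb: "\<bar>G (0, s, a)\<bar> \<le> \<bar>rmax M\<bar> / (1 - discount M)" if "a \<in> actions M" for a
    using G(2)[rule_format, of "(0, s, a)"] s that by (simp add: space_step_space)
  show "advantage M p s \<in> borel_measurable (action_space M)"
    using Gm by (subst measurable_cong[OF adv]) auto
  show "\<exists>B. \<forall>a\<in>actions M. \<bar>advantage M p s a\<bar> \<le> B"
    by (rule exI[of _ "\<bar>rmax M\<bar> / (1 - discount M) + \<bar>V_fun M p s\<bar>"])
       (use adv Gb in \<open>force intro: order_trans[OF abs_triangle_ineq4]\<close>)
  have "integrable D (\<lambda>a. G (0, s, a))"
    by (rule D.integrable_const_bound[where B="\<bar>rmax M\<bar> / (1 - discount M)"])
       (use Gb Gm in \<open>auto simp: D_def\<close>)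
  then have "(LINT a|D. G (0, s, a) - V_fun M p s) = 0"
    by (simp add: D.prob_space G(4)[rule_format, OF s, folded D_def])
  also have "(LINT a|D. G (0, s, a) - V_fun M p s) = (LINT a|D. advantage M p s a)"
    by (rule Bochner_Integration.integral_cong) (auto simp: adv D_def)
  finally show "(LINT a|D. advantage M p s a) = 0" .
qed

end

section \<open>Logarithmic moment generating function of a bounded centered variable\<close>

lemma exp_le_quadratic:
  fixes x :: real
  assumes "x \<le> 1"
  shows "exp x \<le> 1 + x + x\<^sup>2"
proof (cases "0 \<le> x")
  case True
  then show ?thesis using exp_bound[of x] assms by simp
next
  case False
  define y where "y = - x"
  have y: "0 < y" using False by (simp add: y_def)
  have "exp (- y) \<le> 1 / (1 + y)"
    using exp_ge_add_one_self[of y] y by (simp add: exp_minus divide_simps)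
  \<comment> \<open>Here \<open>(1 + y) * (1 - y + y^2) = 1 + y^3\<close>, which is at least
    1.\<close>
  also have "\<dots> \<le> 1 - y + y\<^sup>2"
    using y by (simp add: divide_simps algebra_simps power2_eq_square)
  finally show ?thesis by (simp add: y_def)
qed

context prob_space
begin

context
  fixes f :: "'a \<Rightarrow> real" and B :: real
  assumes f: "f \<in> borel_measurable M"
    and bound: "\<forall>x\<in>space M. \<bar>f x\<bar> \<le> B" and mean: "expectation f = 0"
begin

lemma integrable_of_bound: "integrable M f"
  by (rule integrable_const_bound[where B=B]) (use f bound in auto)

lemma integrable_exp_of_bound:
  assumes "lam > 0"
  shows "integrable M (\<lambda>x. exp (f x / lam))"
proof (rule integrable_const_bound[where B="exp (B / lam)"])
  show "AE x in M. norm (exp (f x / lam)) \<le> exp (B / lam)"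
    using bound assms by (intro AE_I2) (auto simp: divide_right_mono abs_le_iff)
  show "(\<lambda>x. exp (f x / lam)) \<in> borel_measurable M"
    using f by measurable
qed

text \<open>Integrate \<open>1 + x \<le> exp x\<close>; the linear term has mean zero.\<close>

lemma mgf_ge_one:
  assumes "lam > 0"
  shows "1 \<le> expectation (\<lambda>x. exp (f x / lam))"
proof -
  have "expectation (\<lambda>x. 1 + f x / lam) \<le> expectation (\<lambda>x. exp (f x / lam))"
    by (rule integral_mono) (use integrable_of_bound integrable_exp_of_bound[OF assms] in auto)
  then show ?thesis using integrable_of_bound mean by (simp add: prob_space)
qed

text \<open>The vanishing mean removes the first-order term from the quadratic bound on
  \<open>exp\<close>, and \<open>ln z \<le> z - 1\<close> carries the rest over to the logarithm.
  The lower bound 0 is \<open>mgf_ge_one\<close>.\<close>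

lemma log_mgf_bigo:
  "(\<lambda>lam. ln (expectation (\<lambda>x. exp (f x / lam)))) \<in> O[at_top](\<lambda>lam. 1 / lam ^ 2)"
proof -
  \<comment> \<open>The threshold \<open>max 1 B\<close> makes \<open>lam\<close> positive and
    \<open>f x / lam\<close> at most 1, as \<open>exp_le_quadratic\<close> requires.\<close>
  have "norm (ln (expectation (\<lambda>x. exp (f x / lam)))) \<le> B\<^sup>2 * norm (1 / lam ^ 2)" if "lam \<ge> max 1 B" for lam
  proof -
    have lam: "lam > 0" "B \<le> lam" using that by auto
    have "expectation (\<lambda>x. exp (f x / lam)) \<le> expectation (\<lambda>x. 1 + f x / lam + B\<^sup>2 / lam\<^sup>2)"
    proof (rule integral_mono[OF integrable_exp_of_bound[OF lam(1)]])
      show "integrable M (\<lambda>x. 1 + f x / lam + B\<^sup>2 / lam\<^sup>2)" using integrable_of_bound by auto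
      fix x assume "x \<in> space M"
      then have fx: "\<bar>f x\<bar> \<le> B" using bound by blast
      then have "exp (f x / lam) \<le> 1 + f x / lam + (f x / lam)\<^sup>2"
        using lam by (intro exp_le_quadratic) (simp add: divide_simps)
      moreover have "(f x / lam)\<^sup>2 \<le> B\<^sup>2 / lam\<^sup>2"
        using fx lam by (auto simp: power_divide intro!: divide_right_mono abs_le_square_iff[THEN iffD1])
      ultimately show "exp (f x / lam) \<le> 1 + f x / lam + B\<^sup>2 / lam\<^sup>2" by simp
    qed
    also have "\<dots> = 1 + B\<^sup>2 / lam\<^sup>2" using integrable_of_bound mean by (simp add: prob_space)
    finally have "ln (expectation (\<lambda>x. exp (f x / lam))) \<le> B\<^sup>2 / lam\<^sup>2"
      using ln_le_minus_one[of "expectation (\<lambda>x. exp (f x / lam))"] mgf_ge_one[OF lam(1)] by linarith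
    moreover have "0 \<le> ln (expectation (\<lambda>x. exp (f x / lam)))" using mgf_ge_one[OF lam(1)] by simp
    ultimately show ?thesis by simp
  qed
  then show "(\<lambda>lam. ln (expectation (\<lambda>x. exp (f x / lam)))) \<in> O[at_top](\<lambda>lam. 1 / lam ^ 2)"
    by (intro bigoI[where c="B\<^sup>2"] eventually_at_top_linorderI[of "max 1 B"])
qed

end

end

text \<open>The normalizer of \<open>tilted\<close> is the moment generating function of the
  advantage under the policy density, so the difference in question is exactly minus its logarithm
  once \<open>lam > 0\<close>.\<close>

lemma log_tilted_expansion:
  assumes mdp: "discounted_mdp M" and policy: "is_policy M p"
    and s: "s \<in> states M" and a: "a \<in> actions M" and pos: "p s a > 0"
  shows "(\<lambda>lam. ln (tilted M p lam s a) - ln (p s a) - advantage M p s a / lam)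
           \<in> O[at_top](\<lambda>lam. 1 / lam ^ 2)"
proof -
  define D where "D = density (action_space M) (\<lambda>a. ennreal (p s a))"
  interpret D: prob_space D unfolding D_def by (rule action_density_prob_space[OF mdp policy s])
  note adv = advantage_measurable_bounded_centered[OF mdp policy s, folded D_def]
  obtain B where B: "\<forall>a\<in>actions M. \<bar>advantage M p s a\<bar> \<le> B" using adv(2) ..
  have advD: "advantage M p s \<in> borel_measurable D" using adv(1) by (simp add: D_def)
  have "\<forall>a'\<in>space D. \<bar>advantage M p s a'\<bar> \<le> B"
    using B by (simp add: D_def)
  note mgf = D.mgf_ge_one[OF advD this adv(3)] D.log_mgf_bigo[OF advD this adv(3)]
  have Z: "(LINT a'|action_space M. p s a' * exp (advantage M p s a' / lam))
      = D.expectation (\<lambda>a'. exp (advantage M p s a' / lam))" for lam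
    unfolding D_def
    using policy s adv(1) policy_measurable_action[OF mdp policy s]
    by (subst integral_density) (auto simp: is_policy_def)
  have "\<forall>\<^sub>F lam in at_top. ln (tilted M p lam s a) - ln (p s a) - advantage M p s a / lam
      = - ln (D.expectation (\<lambda>a'. exp (advantage M p s a' / lam)))"
    using eventually_gt_at_top[of 0]
  proof eventually_elim
    case (elim lam)
    have "0 < D.expectation (\<lambda>a'. exp (advantage M p s a' / lam))" using mgf(1)[OF elim] by simp
    then show ?case using pos by (simp add: tilted_def Z ln_div ln_mult)
  qed
  then show ?thesis
    using mgf(2) by (simp add: landau_o.big.in_cong)
qed

section \<open>Asymptotic expansions\<close>

lemma differentiable_imp_locally_lipschitz_at:
  fixes f :: "'a::real_normed_vector \<Rightarrow> 'b::real_normed_vector"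
  assumes "f differentiable (at x)"
  shows "\<exists>C. \<forall>\<^sub>F y in nhds x. norm (f y - f x) \<le> C * norm (y - x)"
proof -
  obtain f' where f': "(f has_derivative f') (at x)" using assms by (auto simp: differentiable_def)
  then have bl: "bounded_linear f'" by (rule has_derivative_bounded_linear)
  \<comment> \<open>Tolerance 1 for the linearization error gives the Lipschitz constant
    \<open>onorm f' + 1\<close>.\<close>
  obtain d where d: "d > 0" "\<And>y. norm (y - x) < d \<Longrightarrow> norm (f y - f x - f' (y - x)) \<le> 1 * norm (y - x)"
    using f' unfolding has_derivative_at_alt by (metis zero_less_one)
  have "norm (f y - f x) \<le> (onorm f' + 1) * norm (y - x)" if "dist y x < d" for y
  proof -
    have "norm (f y - f x) \<le> norm (f' (y - x)) + norm (f y - f x - f' (y - x))"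
      by (rule norm_triangle_sub)
    also have "\<dots> \<le> onorm f' * norm (y - x) + 1 * norm (y - x)"
      using that by (intro add_mono onorm[OF bl] d(2)) (simp add: dist_norm)
    finally show ?thesis by (simp add: algebra_simps)
  qed
  then show ?thesis using d(1) unfolding eventually_nhds_metric by blast
qed

lemma has_derivative_gradient:
  fixes f :: "real ^ 'n::finite \<Rightarrow> real"
  assumes "f differentiable (at x)"
  shows "(f has_derivative (\<lambda>h. gradient f x \<bullet> h)) (at x)"
proof -
  have D: "(f has_derivative frechet_derivative f (at x)) (at x)"
    using assms by (simp add: frechet_derivative_works)
  interpret bounded_linear "frechet_derivative f (at x)"
    using D by (rule has_derivative_bounded_linear)
  have "frechet_derivative f (at x) h = gradient f x \<bullet> h" for h
  proof -
    have "h = (\<Sum>i\<in>UNIV. h $ i *\<^sub>R axis i 1)"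
      using basis_expansion[of h] by (simp add: scalar_mult_eq_scaleR)
    then have "frechet_derivative f (at x) h
        = frechet_derivative f (at x) (\<Sum>i\<in>UNIV. h $ i *\<^sub>R axis i 1)"
      by (rule arg_cong)
    also have "\<dots> = (\<Sum>i\<in>UNIV. h $ i *\<^sub>R frechet_derivative f (at x) (axis i 1))"
      by (simp only: sum scaleR)
    finally show ?thesis
      by (simp add: gradient_def partial_deriv_def inner_vec_def mult.commute)
  qed
  then have "frechet_derivative f (at x) = (\<lambda>h. gradient f x \<bullet> h)" by (rule ext)
  then show ?thesis using D by simp
qed

text \<open>Differentiable partial derivatives make the gradient Lipschitz at \<open>x\<close>. The
  mean value inequality for \<open>f\<close> minus its linearization then contributes the second
  factor \<open>norm (y - x)\<close>. The index \<open>Suc (Suc k)\<close> covers every order of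
  smoothness from two on.\<close>

lemma first_order_taylor_C2:
  fixes f :: "real ^ 'n::finite \<Rightarrow> real"
  assumes U: "open U" "x \<in> U" and C2: "C_k_on (Suc (Suc k)) f U"
  shows "\<exists>C. \<forall>\<^sub>F y in nhds x. \<bar>f y - f x - gradient f x \<bullet> (y - x)\<bar> \<le> C * (norm (y - x))\<^sup>2"
proof -
  have diff: "f differentiable (at y)" if "y \<in> U" for y using C2 that by simp
  have "\<forall>i. \<exists>C. \<forall>\<^sub>F y in nhds x. norm (partial_deriv i f y - partial_deriv i f x) \<le> C * norm (y - x)"
    using C2 U by (intro allI differentiable_imp_locally_lipschitz_at) simp
  from choice[OF this] obtain C where C: "\<And>i. \<forall>\<^sub>F y in nhds x.
      norm (partial_deriv i f y - partial_deriv i f x) \<le> C i * norm (y - x)"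
    by blast
  define K where "K = (\<Sum>i\<in>UNIV. C i)"
  have "\<forall>\<^sub>F y in nhds x. \<forall>i. norm (partial_deriv i f y - partial_deriv i f x) \<le> C i * norm (y - x)"
    using C by (simp add: eventually_all_finite)
  then have "\<forall>\<^sub>F y in nhds x. y \<in> U \<and> norm (gradient f y - gradient f x) \<le> K * norm (y - x)"
    using eventually_nhds_in_open[OF U]
  proof eventually_elim
    case (elim y)
    have "norm (gradient f y - gradient f x) \<le> (\<Sum>i\<in>UNIV. \<bar>(gradient f y - gradient f x) $ i\<bar>)"
      by (rule norm_le_l1_cart)
    also have "\<dots> \<le> (\<Sum>i\<in>UNIV. C i * norm (y - x))"
      using elim(1) by (intro sum_mono) (simp add: gradient_def)
    finally show ?case using elim(2) by (simp add: K_def sum_distrib_right)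
  qed
  then obtain d where d: "d > 0"
    "\<And>y. dist y x < d \<Longrightarrow> y \<in> U \<and> norm (gradient f y - gradient f x) \<le> K * norm (y - x)"
    unfolding eventually_nhds_metric by blast
  \<comment> \<open>The sign of \<open>K\<close> has not been established, and enlarging the
    distance needs a nonnegative factor, hence \<open>\<bar>K\<bar>\<close>.\<close>
  have "\<bar>f y - f x - gradient f x \<bullet> (y - x)\<bar> \<le> \<bar>K\<bar> * (norm (y - x))\<^sup>2" if y: "dist y x < d" for y
  proof -
    \<comment> \<open>This ball contains the segment from \<open>x\<close> to \<open>y\<close>, and
      none of its points is farther from \<open>x\<close> than \<open>y\<close> is.\<close>
    let ?S = "cball x (dist y x)"
    have S: "z \<in> U \<and> norm (gradient f z - gradient f x) \<le> \<bar>K\<bar> * norm (y - x)" if "z \<in> ?S" for z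
    proof -
      have z: "dist z x \<le> dist y x" using that by (simp add: dist_commute)
      have "norm (gradient f z - gradient f x) \<le> K * norm (z - x)" using d(2)[of z] z y by simp
      also have "\<dots> \<le> \<bar>K\<bar> * norm (y - x)" using z by (intro mult_mono) (auto simp: dist_norm)
      finally show ?thesis using d(2)[of z] z y by simp
    qed
    have "norm (f y - f x - gradient f x \<bullet> (y - x)) \<le> norm (y - x) * (\<bar>K\<bar> * norm (y - x))"
    proof (rule differentiable_bound_linearization[where S="?S" and f'="\<lambda>z h. gradient f z \<bullet> h" and ?x0.0=x])
      show "x + t *\<^sub>R (y - x) \<in> ?S" if "t \<in> {0..1}" for t
      proof -
        have "dist x (x + t *\<^sub>R (y - x)) = t * dist y x" using that by (simp add: dist_norm)
        also have "\<dots> \<le> dist y x" using that by (intro mult_left_le_one_le) auto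
        finally show ?thesis by simp
      qed
      show "(f has_derivative (\<lambda>h. gradient f z \<bullet> h)) (at z within ?S)" if "z \<in> ?S" for z
        using S[OF that] by (auto intro: has_derivative_at_withinI[OF has_derivative_gradient[OF diff]])
      show "onorm ((\<lambda>h. gradient f z \<bullet> h) - (\<lambda>h. gradient f x \<bullet> h)) \<le> \<bar>K\<bar> * norm (y - x)" if "z \<in> ?S" for z
      proof (rule onorm_le)
        fix h
        have "norm (((\<lambda>h. gradient f z \<bullet> h) - (\<lambda>h. gradient f x \<bullet> h)) h) = \<bar>(gradient f z - gradient f x) \<bullet> h\<bar>"
          by (simp add: inner_diff_left)
        also have "\<dots> \<le> norm (gradient f z - gradient f x) * norm h" by (rule Cauchy_Schwarz_ineq2)
        also have "\<dots> \<le> \<bar>K\<bar> * norm (y - x) * norm h" using S[OF that] by (intro mult_right_mono) auto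
        finally show "norm (((\<lambda>h. gradient f z \<bullet> h) - (\<lambda>h. gradient f x \<bullet> h)) h) \<le> \<bar>K\<bar> * norm (y - x) * norm h" .
      qed
      show "x \<in> ?S" by simp
    qed
    then show ?thesis by (simp add: power2_eq_square mult_ac)
  qed
  then show ?thesis using d(1) unfolding eventually_nhds_metric by blast
qed

section \<open>Landau symbols and inner products with a spanning set\<close>

lemma span_induct_UNIV:
  assumes "span S = UNIV" and "\<And>w. w \<in> S \<Longrightarrow> P w" and "P 0"
    and "\<And>u w. P u \<Longrightarrow> P w \<Longrightarrow> P (u + w)" and "\<And>r w. P w \<Longrightarrow> P (r *\<^sub>R w)"
  shows "P w"
proof -
  have "w \<in> span S" using assms(1) by simp
  then show ?thesis
  proof (rule span_induct)
    show "subspace {w. P w}"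
      by (rule subspaceI) (simp_all only: mem_Collect_eq assms(3-5))
  qed (rule assms(2))
qed

lemma norm_bigo_of_components:
  fixes f :: "real \<Rightarrow> 'b::euclidean_space" and g :: "real \<Rightarrow> real"
  assumes "\<And>b. b \<in> Basis \<Longrightarrow> (\<lambda>x. b \<bullet> f x) \<in> O[F](g)"
  shows "(\<lambda>x. norm (f x)) \<in> O[F](g)"
proof -
  have "(\<lambda>x. \<Sum>b\<in>Basis. \<bar>b \<bullet> f x\<bar>) \<in> O[F](g)"
    using assms by (intro big_sum_in_bigo) simp
  moreover have "(\<lambda>x. norm (f x)) \<in> O[F](\<lambda>x. \<Sum>b\<in>Basis. \<bar>b \<bullet> f x\<bar>)"
    by (intro landau_o.big_mono always_eventually)
       (auto simp: sum_nonneg inner_commute intro: order_trans[OF norm_le_l1])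
  ultimately show ?thesis by (rule landau_o.big_trans[rotated])
qed

text \<open>In \<open>d \<le> C * d^2 + C * \<bar>h\<bar>\<close> the square is at most
  \<open>d / 2\<close> as soon as \<open>d < 1 / (2 * C)\<close>, and it can be moved to the
  left-hand side.\<close>

lemma bigo_absorb_square:
  fixes d :: "real \<Rightarrow> real"
  assumes lim: "(d \<longlongrightarrow> 0) F" and nn: "\<And>x. 0 \<le> d x"
    and bigo: "d \<in> O[F](\<lambda>x. (d x)\<^sup>2 + \<bar>h x\<bar>)"
  shows "d \<in> O[F](h)"
proof -
  obtain C where C: "C > 0" "\<forall>\<^sub>F x in F. norm (d x) \<le> C * norm ((d x)\<^sup>2 + \<bar>h x\<bar>)"
    using bigo by (auto elim: landau_o.bigE)
  have "\<forall>\<^sub>F x in F. d x < 1 / (2 * C)"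
    using C(1) by (intro order_tendstoD[OF lim]) simp
  with C(2) have "\<forall>\<^sub>F x in F. norm (d x) \<le> 2 * C * norm (h x)"
  proof eventually_elim
    case (elim x)
    have "C * d x * d x \<le> 1 / 2 * d x"
      using elim(2) C(1) nn[of x] by (intro mult_right_mono) (auto simp: field_simps)
    moreover have "d x \<le> C * (d x * d x) + C * \<bar>h x\<bar>"
      using elim(1) nn[of x] by (simp add: power2_eq_square algebra_simps)
    ultimately show ?case using nn[of x] by simp
  qed
  then show ?thesis by (rule bigoI)
qed

text \<open>Multiplication by \<open>lam\<close> bounds the constant \<open>\<bar>c\<bar>\<close> by
  \<open>C / lam\<close>, which tends to 0.\<close>

lemma inverse_bigo_inverse_square_imp_zero:
  fixes c :: real
  assumes "(\<lambda>lam. c / lam) \<in> O[at_top](\<lambda>lam. 1 / lam ^ 2)"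
  shows "c = 0"
proof -
  obtain C where C: "C > 0" "\<forall>\<^sub>F lam in at_top. norm (c / lam) \<le> C * norm (1 / lam ^ 2 :: real)"
    using assms by (auto elim: landau_o.bigE)
  have "\<forall>\<^sub>F lam in at_top. \<bar>c\<bar> \<le> C / lam"
    using C(2) eventually_gt_at_top[of 0]
    by eventually_elim (simp add: field_simps power2_eq_square)
  moreover have "((\<lambda>lam. C / lam) \<longlongrightarrow> 0) at_top"
    by (intro real_tendsto_divide_at_top[OF tendsto_const] filterlim_ident)
  ultimately have "\<bar>c\<bar> \<le> 0"
    by (intro tendsto_lowerbound[where F=at_top and f="\<lambda>lam. C / lam"]) auto
  then show ?thesis by simp
qed

lemma overdetermined_expansion:
  fixes \<delta> :: "real \<Rightarrow> 'b::euclidean_space" and g :: "'x \<Rightarrow> 'b" and A :: "'x \<Rightarrow> real"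
  assumes lim: "(\<delta> \<longlongrightarrow> 0) at_top" and span: "span (g ` X) = UNIV"
    and expansion: "\<And>x. x \<in> X \<Longrightarrow>
      (\<lambda>lam. g x \<bullet> \<delta> lam - A x / lam) \<in> O[at_top](\<lambda>lam. (norm (\<delta> lam))\<^sup>2 + 1 / lam ^ 2)"
  obtains v where "\<And>x. x \<in> X \<Longrightarrow> g x \<bullet> v = A x"
    and "(\<lambda>lam. norm (\<delta> lam - (1 / lam) *\<^sub>R v)) \<in> O[at_top](\<lambda>lam. 1 / lam ^ 2)"
proof -
  \<comment> \<open>Knowing the inner products with a spanning set gives the norm of \<open>\<delta> lam\<close> up to its own square,
     which is absorbed since \<open>\<delta>\<close> vanishes; the quadratic error is then of the order of the
     target remainder.\<close>
  let ?q = "\<lambda>lam. (norm (\<delta> lam))\<^sup>2 + \<bar>1 / lam\<bar>"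
  have le: "(\<lambda>lam. (norm (\<delta> lam))\<^sup>2 + 1 / lam ^ 2) \<in> O[at_top](?q)"
  proof (intro landau_o.big_mono eventually_at_top_linorderI[of 1])
    fix lam :: real assume "1 \<le> lam"
    then have "1 / lam ^ 2 \<le> \<bar>1 / lam\<bar>" by (simp add: divide_simps power2_eq_square)
    then show "norm ((norm (\<delta> lam))\<^sup>2 + 1 / lam ^ 2) \<le> norm (?q lam)" by simp
  qed
  have inv: "(\<lambda>lam. c / lam) \<in> O[at_top](?q)" for c
    by (intro bigoI[where c="\<bar>c\<bar>"] always_eventually) (auto simp: divide_simps abs_mult algebra_simps)
  have weak: "(\<lambda>lam. w \<bullet> \<delta> lam) \<in> O[at_top](?q)" for w
  proof (rule span_induct_UNIV[OF span, where P="\<lambda>w. (\<lambda>lam. w \<bullet> \<delta> lam) \<in> O[at_top](?q)"])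
    fix w assume "w \<in> g ` X"
    then obtain x where x: "x \<in> X" "w = g x" by blast
    have "(\<lambda>lam. (g x \<bullet> \<delta> lam - A x / lam) + A x / lam) \<in> O[at_top](?q)"
      by (intro sum_in_bigo inv landau_o.big_trans[OF expansion[OF x(1)] le])
    then show "(\<lambda>lam. w \<bullet> \<delta> lam) \<in> O[at_top](?q)" by (simp add: x(2))
  qed (auto simp: inner_add_left intro: sum_in_bigo)
  have "(\<lambda>lam. norm (\<delta> lam)) \<in> O[at_top](?q)"
    by (rule norm_bigo_of_components) (rule weak)
  then have \<delta>: "(\<lambda>lam. norm (\<delta> lam)) \<in> O[at_top](\<lambda>lam. 1 / lam)"
    by (rule bigo_absorb_square[OF tendsto_norm_zero[OF lim] norm_ge_zero])
  have "(\<lambda>lam. (norm (\<delta> lam))\<^sup>2 + 1 / lam ^ 2) \<in> O[at_top](\<lambda>lam. 1 / lam ^ 2)"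
    using landau_o.big_power[OF \<delta>, of 2] by (intro sum_in_bigo) (auto simp: power_divide)
  then have strong: "(\<lambda>lam. g x \<bullet> \<delta> lam - A x / lam) \<in> O[at_top](\<lambda>lam. 1 / lam ^ 2)" if "x \<in> X" for x
    by (rule landau_o.big_trans[OF expansion[OF that]])
  \<comment> \<open>The directions \<open>w\<close> that admit a first-order coefficient form a
    subspace containing all \<open>g x\<close>, so every direction admits one.\<close>
  have "\<exists>c. (\<lambda>lam. w \<bullet> \<delta> lam - c / lam) \<in> O[at_top](\<lambda>lam. 1 / lam ^ 2)" for w :: 'b
  proof (rule span_induct_UNIV[OF span,
        where P="\<lambda>w. \<exists>c. (\<lambda>lam. w \<bullet> \<delta> lam - c / lam) \<in> O[at_top](\<lambda>lam. 1 / lam ^ 2)"])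
    show "\<exists>c. (\<lambda>lam. w \<bullet> \<delta> lam - c / lam) \<in> O[at_top](\<lambda>lam. 1 / lam ^ 2)" if "w \<in> g ` X" for w
    proof -
      from that obtain x where "x \<in> X" "w = g x" by (elim imageE)
      then show ?thesis using strong[of x] by (intro exI[of _ "A x"]) simp
    qed
    show "\<exists>c. (\<lambda>lam. 0 \<bullet> \<delta> lam - c / lam) \<in> O[at_top](\<lambda>lam. 1 / lam ^ 2)"
      by (rule exI[of _ 0]) simp
  next
    fix u w
    assume "\<exists>c. (\<lambda>lam. u \<bullet> \<delta> lam - c / lam) \<in> O[at_top](\<lambda>lam. 1 / lam ^ 2)"
      and "\<exists>c. (\<lambda>lam. w \<bullet> \<delta> lam - c / lam) \<in> O[at_top](\<lambda>lam. 1 / lam ^ 2)"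
    then obtain c d where "(\<lambda>lam. u \<bullet> \<delta> lam - c / lam) \<in> O[at_top](\<lambda>lam. 1 / lam ^ 2)"
      and "(\<lambda>lam. w \<bullet> \<delta> lam - d / lam) \<in> O[at_top](\<lambda>lam. 1 / lam ^ 2)"
      by (elim exE)
    from sum_in_bigo(1)[OF this] show "\<exists>c. (\<lambda>lam. (u + w) \<bullet> \<delta> lam - c / lam) \<in> O[at_top](\<lambda>lam. 1 / lam ^ 2)"
      by (intro exI[of _ "c + d"]) (simp add: inner_add_left add_divide_distrib algebra_simps)
  next
    fix r w
    assume "\<exists>c. (\<lambda>lam. w \<bullet> \<delta> lam - c / lam) \<in> O[at_top](\<lambda>lam. 1 / lam ^ 2)"
    then obtain c where "(\<lambda>lam. w \<bullet> \<delta> lam - c / lam) \<in> O[at_top](\<lambda>lam. 1 / lam ^ 2)"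
      by (elim exE)
    then have "(\<lambda>lam. r * (w \<bullet> \<delta> lam - c / lam)) \<in> O[at_top](\<lambda>lam. 1 / lam ^ 2)"
      by (cases "r = 0") simp_all
    then show "\<exists>c. (\<lambda>lam. (r *\<^sub>R w) \<bullet> \<delta> lam - c / lam) \<in> O[at_top](\<lambda>lam. 1 / lam ^ 2)"
      by (intro exI[of _ "r * c"]) (simp add: algebra_simps)
  qed
  then have "\<forall>w. \<exists>c. (\<lambda>lam. w \<bullet> \<delta> lam - c / lam) \<in> O[at_top](\<lambda>lam. 1 / lam ^ 2)" ..
  from choice[OF this] obtain c where c: "\<forall>w. (\<lambda>lam. w \<bullet> \<delta> lam - c w / lam) \<in> O[at_top](\<lambda>lam. 1 / lam ^ 2)"
    by (elim exE)
  \<comment> \<open>The coefficients along the basis vectors are assembled into the first-order term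
    of \<open>\<delta>\<close>.\<close>
  define v where "v = (\<Sum>b\<in>Basis. c b *\<^sub>R b)"
  have v: "(\<lambda>lam. norm (\<delta> lam - (1 / lam) *\<^sub>R v)) \<in> O[at_top](\<lambda>lam. 1 / lam ^ 2)"
  proof (rule norm_bigo_of_components)
    fix b :: 'b assume "b \<in> Basis"
    then have "b \<bullet> v = c b" by (simp add: v_def inner_commute[of b])
    then show "(\<lambda>lam. b \<bullet> (\<delta> lam - (1 / lam) *\<^sub>R v)) \<in> O[at_top](\<lambda>lam. 1 / lam ^ 2)"
      using c[rule_format, of b] by (simp add: inner_diff_right)
  qed
  show thesis
  proof (rule that[OF _ v])
    fix x assume x: "x \<in> X"
    have "(\<lambda>lam. g x \<bullet> (\<delta> lam - (1 / lam) *\<^sub>R v)) \<in> O[at_top](\<lambda>lam. norm (\<delta> lam - (1 / lam) *\<^sub>R v))"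
      by (intro bigoI[where c="norm (g x)"] always_eventually) (simp add: Cauchy_Schwarz_ineq2)
    from landau_o.big_trans[OF this v]
    \<comment> \<open>Two second-order expansions of \<open>g x \<bullet> \<delta> lam\<close> are
      compared. Their difference is a constant over \<open>lam\<close>, so the constant vanishes and
      the overdetermined system for \<open>v\<close> is consistent.\<close>
    have "(\<lambda>lam. g x \<bullet> (\<delta> lam - (1 / lam) *\<^sub>R v) - (g x \<bullet> \<delta> lam - A x / lam)) \<in> O[at_top](\<lambda>lam. 1 / lam ^ 2)"
      by (rule sum_in_bigo(2)) (rule strong[OF x])
    then have "(\<lambda>lam. (A x - g x \<bullet> v) / lam) \<in> O[at_top](\<lambda>lam. 1 / lam ^ 2)"
      by (simp add: inner_diff_right diff_divide_distrib)
    then have "A x - g x \<bullet> v = 0" by (rule inverse_bigo_inverse_square_imp_zero)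
    then show "g x \<bullet> v = A x" by simp
  qed
qed

section \<open>Outer products and inverses of positive definite matrices\<close>

lemma outer_mult_vec: "outer u v *v w = (v \<bullet> w) *\<^sub>R u"
  by (simp add: vec_eq_iff outer_def matrix_vector_mult_def inner_vec_def sum_distrib_left mult_ac)

text \<open>Allows the product with a fixed vector to move under the integral that defines
  \<open>fisher\<close>.\<close>

lemma bounded_linear_mult_vec: "bounded_linear (\<lambda>A :: real ^ 'n::finite ^ 'm::finite. A *v w)"
  unfolding linear_conv_bounded_linear[symmetric]
  by (rule linearI) (simp_all add: matrix_vector_mult_add_rdistrib scaleR_matrix_vector_assoc)

text \<open>A positive definite matrix has trivial kernel, hence is invertible; only then is the
  choice in \<open>matrix_inv\<close> known to be an inverse.\<close>

lemma pos_def_matrix_inv_mult: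
  assumes "pos_def A"
  shows "matrix_inv A *v (A *v v) = v"
proof -
  have "\<forall>x. A *v x = 0 \<longrightarrow> x = 0" using assms by (force simp: pos_def_def)
  then have "invertible A"
    by (simp add: invertible_left_inverse matrix_left_invertible_ker)
  then have "matrix_inv A ** A = mat 1"
    unfolding invertible_def matrix_inv_def by (rule someI2_ex) simp
  then show ?thesis
    by (simp add: matrix_vector_mul_assoc)
qed

section \<open>The natural gradient step\<close>

text \<open>Identities that hold at every state-action pair can be inserted under the integral by
  congruence on this set.\<close>

lemma space_occupancy_policy: "space (occupancy_policy M p) = states M \<times> actions M"
proof -
  have "space (occupancy M p) = states M"
    unfolding occupancy_def
    by (rule space_measure_of) (use sets.space_closed[of "state_space M"] in simp)
  then show ?thesis by (simp add: occupancy_policy_def space_pair_measure)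
qed

lemma fisher_mult_vec:
  assumes "integrable (occupancy_policy M (pol \<theta>)) (\<lambda>(s, a). outer (score pol \<theta> s a) (score pol \<theta> s a))"
  shows "fisher M pol \<theta> *v w
     = (LINT (s, a)|occupancy_policy M (pol \<theta>). (score pol \<theta> s a \<bullet> w) *\<^sub>R score pol \<theta> s a)"
  unfolding fisher_def integral_bounded_linear[OF bounded_linear_mult_vec assms, symmetric]
  by (simp add: split_beta' outer_mult_vec)

text \<open>A nonzero vector orthogonal to all scores would be annihilated by the Fisher matrix,
  against positive definiteness.\<close>

lemma span_score_eq_UNIV:
  assumes int: "integrable (occupancy_policy M (pol \<theta>)) (\<lambda>(s, a). outer (score pol \<theta> s a) (score pol \<theta> s a))"
    and pd: "pos_def (fisher M pol \<theta>)"
  shows "span ((\<lambda>(s, a). score pol \<theta> s a) ` (states M \<times> actions M)) = UNIV"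
proof (rule ccontr)
  assume "\<not> ?thesis"
  then obtain w where "w \<noteq> 0"
    and w: "\<forall>x\<in>span ((\<lambda>(s, a). score pol \<theta> s a) ` (states M \<times> actions M)). w \<bullet> x = 0"
    using span_not_UNIV_orthogonal by blast
  have orth: "score pol \<theta> s a \<bullet> w = 0" if "s \<in> states M" "a \<in> actions M" for s a
  proof -
    have "score pol \<theta> s a \<in> span ((\<lambda>(s, a). score pol \<theta> s a) ` (states M \<times> actions M))"
      using that by (intro span_base) force
    then show ?thesis using w by (metis inner_commute)
  qed
  have "fisher M pol \<theta> *v w = (LINT x|occupancy_policy M (pol \<theta>). 0)"
    unfolding fisher_mult_vec[OF int]
    by (rule Bochner_Integration.integral_cong) (auto simp: space_occupancy_policy orth)
  then have "w \<bullet> (fisher M pol \<theta> *v w) = 0" by simp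
  then show False using pd \<open>w \<noteq> 0\<close> by (force simp: pos_def_def)
qed

text \<open>Vanishing \<open>1 / lam\<close> is the filter \<open>at_top\<close>, and the vector
  remainder enters the Landau class through its norm. The lists \<open>js\<close> of length 1 to 3
  encode the partial derivatives of those orders; positivity on \<open>U\<close> makes
  \<open>ln\<close> the true log-density there.\<close>

theorem propositionA1:
  fixes M :: "('s::euclidean_space, 'a::euclidean_space) mdp"
    and \<Theta> U :: "(real ^ 'n::finite) set"
    and pol :: "real ^ 'n \<Rightarrow> 's \<Rightarrow> 'a \<Rightarrow> real"
    and \<theta>k :: "real ^ 'n"
    and \<theta>next :: "real \<Rightarrow> real ^ 'n"
  assumes mdp: "discounted_mdp M"
    and family: "\<And>\<theta>. \<theta> \<in> \<Theta> \<Longrightarrow> is_policy M (pol \<theta>)"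
    and k: "\<theta>k \<in> \<Theta>"
    and next_in: "\<And>lam. lam > 0 \<Longrightarrow> \<theta>next lam \<in> \<Theta>"
    and next_tilted: "\<And>lam s a. lam > 0 \<Longrightarrow> s \<in> states M \<Longrightarrow> a \<in> actions M \<Longrightarrow>
           pol (\<theta>next lam) s a = tilted M (pol \<theta>k) lam s a"
    and next_tendsto: "(\<theta>next \<longlongrightarrow> \<theta>k) at_top"
    and nbhd: "open U" "\<theta>k \<in> U" "U \<subseteq> \<Theta>"
    and pos: "\<And>\<theta> s a. \<theta> \<in> U \<Longrightarrow> s \<in> states M \<Longrightarrow> a \<in> actions M \<Longrightarrow> pol \<theta> s a > 0"
    and C3: "\<And>s a. s \<in> states M \<Longrightarrow> a \<in> actions M \<Longrightarrow> C_k_on 3 (\<lambda>\<theta>. ln (pol \<theta> s a)) U"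
    and integrable_derivs: "\<And>\<theta> js. \<theta> \<in> U \<Longrightarrow> 1 \<le> length js \<Longrightarrow> length js \<le> 3 \<Longrightarrow>
           integrable (occupancy_policy M (pol \<theta>k))
             (\<lambda>(s, a). foldr partial_deriv js (\<lambda>\<theta>'. ln (pol \<theta>' s a)) \<theta>)"
    and integrable_fisher: "integrable (occupancy_policy M (pol \<theta>k))
             (\<lambda>(s, a). outer (score pol \<theta>k s a) (score pol \<theta>k s a))"
    and pd: "pos_def (fisher M pol \<theta>k)"
  shows "(\<lambda>lam. norm (\<theta>next lam -
            (\<theta>k + (1 / lam) *\<^sub>R (matrix_inv (fisher M pol \<theta>k) *v
               (LINT (s, a)|occupancy_policy M (pol \<theta>k).
                  advantage M (pol \<theta>k) s a *\<^sub>R score pol \<theta>k s a)))))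
         \<in> O[at_top](\<lambda>lam. 1 / lam ^ 2)"
proof -
  let ?X = "states M \<times> actions M"
  let ?g = "\<lambda>(s, a). score pol \<theta>k s a"
  let ?A = "\<lambda>(s, a). advantage M (pol \<theta>k) s a"
  let ?\<delta> = "\<lambda>lam. \<theta>next lam - \<theta>k"
  let ?r = "\<lambda>lam. (norm (?\<delta> lam))\<^sup>2 + 1 / lam ^ 2"
  have lim: "(?\<delta> \<longlongrightarrow> 0) at_top" using next_tendsto by (rule Lim_null[THEN iffD1])
  have expansion: "(\<lambda>lam. ?g x \<bullet> ?\<delta> lam - ?A x / lam) \<in> O[at_top](?r)" if "x \<in> ?X" for x
  proof -
    obtain s a where x: "x = (s, a)" and s: "s \<in> states M" and a: "a \<in> actions M"
      using \<open>x \<in> ?X\<close> by blast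
    let ?l = "\<lambda>\<theta>. ln (pol \<theta> s a)"
    have "C_k_on (Suc (Suc 1)) ?l U" using C3[OF s a] by (simp add: numeral_3_eq_3)
    from first_order_taylor_C2[OF nbhd(1,2) this] obtain C where
      "\<forall>\<^sub>F \<theta> in nhds \<theta>k. \<bar>?l \<theta> - ?l \<theta>k - score pol \<theta>k s a \<bullet> (\<theta> - \<theta>k)\<bar> \<le> C * (norm (\<theta> - \<theta>k))\<^sup>2"
      unfolding score_def by blast
    \<comment> \<open>The Taylor bound holds on \<open>nhds\<close>, which includes the center, so
      \<open>\<theta>next lam\<close> may coincide with \<open>\<theta>k\<close>.\<close>
    from eventually_compose_filterlim[OF this next_tendsto]
    have taylor: "(\<lambda>lam. ?l (\<theta>next lam) - ?l \<theta>k - score pol \<theta>k s a \<bullet> ?\<delta> lam) \<in> O[at_top](\<lambda>lam. (norm (?\<delta> lam))\<^sup>2)"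
      by (intro bigoI[where c=C]) simp
    have tilt: "(\<lambda>lam. ?l (\<theta>next lam) - ?l \<theta>k - advantage M (pol \<theta>k) s a / lam) \<in> O[at_top](\<lambda>lam. 1 / lam ^ 2)"
    proof (rule landau_o.big.in_cong[THEN iffD2])
      show "(\<lambda>lam. ln (tilted M (pol \<theta>k) lam s a) - ?l \<theta>k - advantage M (pol \<theta>k) s a / lam) \<in> O[at_top](\<lambda>lam. 1 / lam ^ 2)"
        by (rule log_tilted_expansion[OF mdp family[OF k] s a pos[OF nbhd(2) s a]])
      show "\<forall>\<^sub>F lam in at_top. ?l (\<theta>next lam) - ?l \<theta>k - advantage M (pol \<theta>k) s a / lam
          = ln (tilted M (pol \<theta>k) lam s a) - ?l \<theta>k - advantage M (pol \<theta>k) s a / lam"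
        using eventually_gt_at_top[of 0] by eventually_elim (simp add: next_tilted s a)
    qed
    have "(\<lambda>lam. (norm (?\<delta> lam))\<^sup>2) \<in> O[at_top](?r)" "(\<lambda>lam. 1 / lam ^ 2) \<in> O[at_top](?r)"
      by (intro landau_o.big_mono always_eventually allI; simp)+
    note landau_o.big_trans[OF tilt this(2)] landau_o.big_trans[OF taylor this(1)]
    \<comment> \<open>Subtracting the Taylor estimate from the tilting estimate cancels the
      log-density ratio.\<close>
    from sum_in_bigo(2)[OF this] show ?thesis by (simp add: x)
  qed
  from overdetermined_expansion[OF lim span_score_eq_UNIV[OF integrable_fisher pd] expansion]
  obtain v where v: "\<And>x. x \<in> ?X \<Longrightarrow> ?g x \<bullet> v = ?A x"
    and expand: "(\<lambda>lam. norm (?\<delta> lam - (1 / lam) *\<^sub>R v)) \<in> O[at_top](\<lambda>lam. 1 / lam ^ 2)"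
    by blast
  \<comment> \<open>With the advantage replaced by the inner product of score and \<open>v\<close>,
    the integrand is that of \<open>fisher_mult_vec\<close>; inverting the Fisher matrix then
    returns \<open>v\<close>.\<close>
  have "(LINT (s, a)|occupancy_policy M (pol \<theta>k). advantage M (pol \<theta>k) s a *\<^sub>R score pol \<theta>k s a)
      = fisher M pol \<theta>k *v v"
    unfolding fisher_mult_vec[OF integrable_fisher]
    by (rule Bochner_Integration.integral_cong) (use v in \<open>auto simp: space_occupancy_policy\<close>)
  then show ?thesis
    using expand by (simp add: pos_def_matrix_inv_mult[OF pd] diff_diff_eq)
qed

end
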